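(* The moment map $m:\mathbb{P}V_n\to\mathrm{i}\mathfrak{u}(n)$, the functional square norm of the moment map $F_n=\|m\|^2:\mathbb{P}V_n\to\mathbb{R}$ and the gradient of $F_n$ are respectively given by $$m([\mu])=M_\mu,\qquad F_n([\mu])=\mathrm{tr}\,M_\mu^2,\qquad \mathrm{grad}(F_n)_{[\mu]}=-8\,\pi_*\delta_\mu(M_\mu),\qquad \|\mu\|=1,$$ where $\pi_*$ denotes the derivative (at $\mu$) of the canonical projection $\pi:V_n\setminus\{0\}\to\mathbb{P}V_n$. Moreover, for $[\mu]\in\mathbb{P}V_n$ the following statements are equivalent: (i) $[\mu]$ is a critical point of $F_n$. (ii) $[\mu]$ is a critical point of $F_n|_{\mathrm{GL}(n).[\mu]}$. (iii) $M_\mu=cI+D$ for some $c\in\mathbb{R}$ and $D\in\mathrm{Der}(\mu)$.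
   Context: $V_n=\Lambda^2(\mathbb{C}^n)^*\otimes\mathbb{C}^n$ is the space of alternating bilinear maps $\mathbb{C}^n\times\mathbb{C}^n\to\mathbb{C}^n$, with $\mathrm{GL}(n)=\mathrm{GL}(n,\mathbb{C})$ acting by $g.\mu(X,Y)=g\mu(g^{-1}X,g^{-1}Y)$ and on the projective space $\mathbb{P}V_n$ by $g.[\mu]=[g.\mu]$. Fix the usual hermitian inner product $\langle\cdot,\cdot\rangle$ on $\mathbb{C}^n$; ${}^*$ is the adjoint with respect to it. On $V_n$ use $\langle\mu,\lambda\rangle=\sum_{i,j,k}\langle\mu(X_i,X_j),X_k\rangle\overline{\langle\lambda(X_i,X_j),X_k\rangle}$, $\{X_i\}$ any orthonormal basis of $\mathbb{C}^n$, and on $\mathfrak{gl}(n)$ use $(A,B)=\mathrm{tr}\,AB^*$. $\mathrm{i}\mathfrak{u}(n)$ is the space of hermitian matrices. The moment map $m$ is defined by: for $0\neq\mu\in V_n$, $m([\mu])\in\mathrm{i}\mathfrak{u}(n)$ is the unique element with $(m([\mu]),A)=\frac{1}{\|\mu\|^2}(d\rho_\mu)_I(A)$ for all $A\in\mathrm{i}\mathfrak{u}(n)$, where $\rho_\mu:\mathrm{GL}(n)\to\mathbb{R}$, $\rho_\mu(g)=\|g.\mu\|^2$. For $\mu\in V_n$, $\mathrm{ad}_\mu X(Y)=\mu(X,Y)$, $$M_\mu=-4\sum_i(\mathrm{ad}_\mu X_i)^*\mathrm{ad}_\mu X_i+2\sum_i\mathrm{ad}_\mu X_i(\mathrm{ad}_\mu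 X_i)^*,$$ $\delta_\mu:\mathfrak{gl}(n)\to V_n$ is $\delta_\mu(A)=\mu(A\cdot,\cdot)+\mu(\cdot,A\cdot)-A\mu(\cdot,\cdot)$, and $\mathrm{Der}(\mu)=\ker\delta_\mu$. The gradient is taken with respect to the Fubini–Study Riemannian metric on $\mathbb{P}V_n$ for which $\pi$, restricted to the unit sphere of $(V_n,\mathrm{Re}\langle\cdot,\cdot\rangle)$, is a Riemannian submersion. *)

theory Defs
  imports "HOL-Analysis.Analysis"
begin

definition herm :: "complex^'n \<Rightarrow> complex^'n \<Rightarrow> complex"
  where "herm x y = (\<Sum>k\<in>UNIV. x $ k * cnj (y $ k))"

definition adj :: "complex^'n^'n \<Rightarrow> complex^'n^'n"
  where "adj A = (\<chi> i j. cnj (A $ j $ i))"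

lemma herm_adj: "herm (A *v x) y = herm x (adj A *v y)"
proof -
  have "herm (A *v x) y = (\<Sum>k\<in>UNIV. \<Sum>j\<in>UNIV. A $ k $ j * x $ j * cnj (y $ k))"
    by (simp add: herm_def matrix_vector_mult_def sum_distrib_right)
  also have "\<dots> = (\<Sum>j\<in>UNIV. \<Sum>k\<in>UNIV. A $ k $ j * x $ j * cnj (y $ k))"
    by (rule sum.swap)
  also have "\<dots> = herm x (adj A *v y)"
    by (simp add: herm_def adj_def matrix_vector_mult_def sum_distrib_left ac_simps)
  finally show ?thesis .
qed

definition hermitian :: "complex^'n^'n \<Rightarrow> bool"
  where "hermitian A \<longleftrightarrow> adj A = A"

definition gl_inner :: "complex^'n^'n \<Rightarrow> complex^'n^'n \<Rightarrow> complex"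
  where "gl_inner A B = trace (A ** adj B)"

definition alt_bilinear :: "(complex^'n \<Rightarrow> complex^'n \<Rightarrow> complex^'n) \<Rightarrow> bool"
  where "alt_bilinear \<mu> \<longleftrightarrow>
    (\<forall>X. Vector_Spaces.linear (*s) (*s) (\<lambda>Y. \<mu> X Y)) \<and>
    (\<forall>Y. Vector_Spaces.linear (*s) (*s) (\<lambda>X. \<mu> X Y)) \<and>
    (\<forall>X. \<mu> X X = 0)"

lemma alt_bilinear_iff:
  "alt_bilinear \<mu> \<longleftrightarrow>
    (\<forall>X Y Z. \<mu> X (Y + Z) = \<mu> X Y + \<mu> X Z) \<and> (\<forall>c X Y. \<mu> X (c *s Y) = c *s \<mu> X Y) \<and>
    (\<forall>X Y Z. \<mu> (X + Y) Z = \<mu> X Z + \<mu> Y Z) \<and> (\<forall>c X Y. \<mu> (c *s X) Y = c *s \<mu> X Y) \<and>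
    (\<forall>X. \<mu> X X = 0)"
  unfolding alt_bilinear_def linear_iff_module_hom module_hom_def module_hom_axioms_def
  using vec.module_axioms by blast

lemma alt_bilinear_anti:
  assumes "alt_bilinear \<mu>" shows "\<mu> X Y + \<mu> Y X = 0"
proof -
  have "\<mu> (X + Y) (X + Y) = 0" "\<mu> X X = 0" "\<mu> Y Y = 0"
    using assms by (auto simp: alt_bilinear_iff)
  moreover have "\<mu> (X + Y) (X + Y) = \<mu> X X + \<mu> Y X + (\<mu> X Y + \<mu> Y Y)"
    using assms unfolding alt_bilinear_iff by metis
  ultimately show ?thesis by (simp add: add.commute)
qed

typedef 'n alt = "{\<mu> :: complex^'n \<Rightarrow> complex^'n \<Rightarrow> complex^'n. alt_bilinear \<mu>}"
  morphisms app Alt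
  by (rule exI[of _ "\<lambda>X Y. 0"]) (simp add: alt_bilinear_iff)

setup_lifting type_definition_alt

text \<open>
  The standard basis \<open>axis i 1\<close> serves as the orthonormal basis here and in \<open>M\<close> below; neither
  sum depends on this choice. The norm and topology on \<open>alt\<close> come from the real part of \<open>herm_alt\<close>.
\<close>

definition herm_alt :: "'n::finite alt \<Rightarrow> 'n alt \<Rightarrow> complex"
  where "herm_alt \<mu> \<nu> = (\<Sum>i\<in>UNIV. \<Sum>j\<in>UNIV. \<Sum>k\<in>UNIV.
    herm (app \<mu> (axis i 1) (axis j 1)) (axis k 1) *
    cnj (herm (app \<nu> (axis i 1) (axis j 1)) (axis k 1)))"

lift_definition cscale :: "complex \<Rightarrow> 'n::finite alt \<Rightarrow> 'n alt"
  is "\<lambda>c \<mu> X Y. c *s \<mu> X Y"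
  by (auto simp: alt_bilinear_iff vector_add_ldistrib vec.scale_left_commute)

instantiation alt :: (finite) real_inner
begin

lift_definition zero_alt :: "'a alt" is "\<lambda>X Y. 0"
  by (simp add: alt_bilinear_iff)
lift_definition plus_alt :: "'a alt \<Rightarrow> 'a alt \<Rightarrow> 'a alt" is "\<lambda>\<mu> \<nu> X Y. \<mu> X Y + \<nu> X Y"
  by (auto simp: alt_bilinear_iff vector_add_ldistrib)
lift_definition minus_alt :: "'a alt \<Rightarrow> 'a alt \<Rightarrow> 'a alt" is "\<lambda>\<mu> \<nu> X Y. \<mu> X Y - \<nu> X Y"
  by (auto simp: alt_bilinear_iff vector_ssub_ldistrib)
lift_definition uminus_alt :: "'a alt \<Rightarrow> 'a alt" is "\<lambda>\<mu> X Y. - \<mu> X Y"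
  by (auto simp: alt_bilinear_iff)
definition scaleR_alt :: "real \<Rightarrow> 'a alt \<Rightarrow> 'a alt"
  where "scaleR_alt r \<mu> = cscale (complex_of_real r) \<mu>"
definition inner_alt :: "'a alt \<Rightarrow> 'a alt \<Rightarrow> real"
  where "inner_alt \<mu> \<nu> = Re (herm_alt \<mu> \<nu>)"
definition norm_alt :: "'a alt \<Rightarrow> real"
  where "norm_alt \<mu> = sqrt (inner \<mu> \<mu>)"
definition sgn_alt :: "'a alt \<Rightarrow> 'a alt"
  where "sgn_alt \<mu> = scaleR (inverse (norm \<mu>)) \<mu>"
definition dist_alt :: "'a alt \<Rightarrow> 'a alt \<Rightarrow> real"
  where "dist_alt \<mu> \<nu> = norm (\<mu> - \<nu>)"
definition uniformity_alt :: "('a alt \<times> 'a alt) filter"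
  where "uniformity_alt = (INF e\<in>{0<..}. principal {(x, y). dist x y < e})"
definition open_alt :: "'a alt set \<Rightarrow> bool"
  where "open_alt U \<longleftrightarrow> (\<forall>x\<in>U. \<forall>\<^sub>F (x', y) in uniformity. x' = x \<longrightarrow> y \<in> U)"

lemma herm_axis: "herm x (axis k 1) = x $ k"
  by (simp add: herm_def axis_def if_distrib[of cnj] if_distrib[of "(*) _"] cong: if_cong)

lemma inner_alt_sum:
  "inner \<mu> \<nu> = (\<Sum>i\<in>UNIV. \<Sum>j\<in>UNIV. \<Sum>k\<in>UNIV. inner (app \<mu> (axis i 1) (axis j 1) $ k)
    (app \<nu> (axis i 1) (axis j 1) $ k))" for \<mu> \<nu> :: "'a alt"
  by (simp add: inner_alt_def herm_alt_def herm_axis inner_complex_def)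

lemma app_eq_0I:
  fixes \<mu> :: "'a alt"
  assumes "\<And>i j. app \<mu> (axis i 1) (axis j 1) = 0"
  shows "\<mu> = 0"
proof -
  have lin: "Vector_Spaces.linear (*s) (*s) (\<lambda>Y. app \<mu> X Y)"
    "Vector_Spaces.linear (*s) (*s) (\<lambda>X. app \<mu> X Y)" for X Y
    using app[of \<mu>] by (auto simp: alt_bilinear_def)
  have 1: "app \<mu> (axis i 1) Y = 0" for i Y
    using assms by (subst basis_expansion[of Y, symmetric])
      (simp add: linear_iff_module_hom module_hom.sum[OF lin(1)[unfolded linear_iff_module_hom]]
        module_hom.scale[OF lin(1)[unfolded linear_iff_module_hom]])
  have "app \<mu> X Y = 0" for X Y
    by (subst basis_expansion[of X, symmetric])
      (simp add: 1 module_hom.sum[OF lin(2)[unfolded linear_iff_module_hom]]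
        module_hom.scale[OF lin(2)[unfolded linear_iff_module_hom]])
  then show ?thesis by transfer (auto simp: fun_eq_iff)
qed

instance
proof
  fix \<mu> \<nu> \<kappa> :: "'a alt" and a b r :: real
  show "\<mu> + \<nu> + \<kappa> = \<mu> + (\<nu> + \<kappa>)" by transfer (simp add: add.assoc)
  show "\<mu> + \<nu> = \<nu> + \<mu>" by transfer (simp add: add.commute)
  show "0 + \<mu> = \<mu>" by transfer simp
  show "- \<mu> + \<mu> = 0" by transfer simp
  show "\<mu> - \<nu> = \<mu> + - \<nu>" by transfer simp
  show "a *\<^sub>R (\<mu> + \<nu>) = a *\<^sub>R \<mu> + a *\<^sub>R \<nu>"
    unfolding scaleR_alt_def by transfer (simp add: vector_add_ldistrib)
  show "(a + b) *\<^sub>R \<mu> = a *\<^sub>R \<mu> + b *\<^sub>R \<mu>"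
    unfolding scaleR_alt_def by transfer (simp add: vector_sadd_rdistrib)
  show "a *\<^sub>R b *\<^sub>R \<mu> = (a * b) *\<^sub>R \<mu>"
    unfolding scaleR_alt_def by transfer (simp add: vector_smult_assoc)
  show "1 *\<^sub>R \<mu> = \<mu>" unfolding scaleR_alt_def by transfer simp
  show "sgn \<mu> = scaleR (inverse (norm \<mu>)) \<mu>" by (fact sgn_alt_def)
  show "dist \<mu> \<nu> = norm (\<mu> - \<nu>)" by (fact dist_alt_def)
  show "uniformity = (INF e\<in>{0<..}. principal {(x, y :: 'a alt). dist x y < e})"
    by (fact uniformity_alt_def)
  show "open U \<longleftrightarrow> (\<forall>x\<in>U. \<forall>\<^sub>F (x', y) in uniformity. x' = x \<longrightarrow> y \<in> U)"
    for U :: "'a alt set" by (fact open_alt_def)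
  show "inner \<mu> \<nu> = inner \<nu> \<mu>" by (simp add: inner_alt_sum inner_commute)
  show "inner (\<mu> + \<nu>) \<kappa> = inner \<mu> \<kappa> + inner \<nu> \<kappa>"
    by (simp add: inner_alt_sum plus_alt.rep_eq inner_add_left sum.distrib)
  show "inner (r *\<^sub>R \<mu>) \<nu> = r * inner \<mu> \<nu>"
    by (simp add: inner_alt_sum scaleR_alt_def cscale.rep_eq sum_distrib_left
        inner_complex_def algebra_simps)
  show "0 \<le> inner \<mu> \<mu>" by (simp add: inner_alt_sum sum_nonneg)
  show "inner \<mu> \<mu> = 0 \<longleftrightarrow> \<mu> = 0"
  proof
    assume "inner \<mu> \<mu> = 0"
    then have "app \<mu> (axis i 1) (axis j 1) = 0" for i j
      by (simp add: inner_alt_sum sum_nonneg_eq_0_iff sum_nonneg vec_eq_iff)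
    then show "\<mu> = 0" by (rule app_eq_0I)
  qed (simp add: inner_alt_sum zero_alt.rep_eq)
  show "norm \<mu> = sqrt (inner \<mu> \<mu>)" by (fact norm_alt_def)
qed

end

text \<open>Only invertible \<open>g\<close> are of interest; \<open>matrix_inv g\<close> is unspecified otherwise.\<close>

lift_definition act :: "complex^('n::finite)^'n \<Rightarrow> 'n alt \<Rightarrow> 'n alt"
  is "\<lambda>g \<mu> X Y. g *v \<mu> (matrix_inv g *v X) (matrix_inv g *v Y)"
  by (auto simp: alt_bilinear_iff matrix_vector_right_distrib vector_scalar_commute)

definition ad :: "'n::finite alt \<Rightarrow> complex^'n \<Rightarrow> complex^'n^'n"
  where "ad \<mu> X = matrix (\<lambda>Y. app \<mu> X Y)"

definition M :: "'n::finite alt \<Rightarrow> complex^'n^'n"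
  where "M \<mu> =
    (- 4) *\<^sub>R (\<Sum>i\<in>UNIV. adj (ad \<mu> (axis i 1)) ** ad \<mu> (axis i 1)) +
    2 *\<^sub>R (\<Sum>i\<in>UNIV. ad \<mu> (axis i 1) ** adj (ad \<mu> (axis i 1)))"

lift_definition delta :: "'n::finite alt \<Rightarrow> complex^'n^'n \<Rightarrow> 'n alt"
  is "\<lambda>\<mu> A X Y. \<mu> (A *v X) Y + \<mu> X (A *v Y) - A *v \<mu> X Y"
  subgoal for \<mu> A
    using alt_bilinear_anti[of \<mu>]
    by (auto simp: alt_bilinear_iff matrix_vector_right_distrib vector_scalar_commute
        vector_add_ldistrib vector_ssub_ldistrib)
  done

definition Der :: "'n::finite alt \<Rightarrow> (complex^'n^'n) set"
  where "Der \<mu> = {A. delta \<mu> A = 0}"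

text \<open>
  The class \<open>[\<mu>]\<close> is the set of nonzero multiples of \<open>\<mu>\<close>. The projective space is a set rather
  than a type because it is empty in dimension one.
\<close>

definition proj :: "'n::finite alt \<Rightarrow> 'n alt set"
  where "proj \<mu> = {cscale c \<mu> | c. c \<noteq> 0}"

definition PV :: "'n::finite alt set set"
  where "PV = {proj \<mu> | \<mu>. \<mu> \<noteq> 0}"

definition act_proj :: "complex^('n::finite)^'n \<Rightarrow> 'n alt set \<Rightarrow> 'n alt set"
  where "act_proj g p = act g ` p"

lemma act_proj: "act_proj g (proj \<mu>) = proj (act g \<mu>)"
proof -
  have "act g (cscale c \<mu>) = cscale c (act g \<mu>)" for c
    by transfer (simp add: vector_scalar_commute)
  then have "act g ` (\<lambda>c. cscale c \<mu>) ` {c. c \<noteq> 0} = (\<lambda>c. cscale c (act g \<mu>)) ` {c. c \<noteq> 0}"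
    by (simp add: image_image)
  then show ?thesis by (simp add: act_proj_def proj_def setcompr_eq_image)
qed

definition orbit :: "'n::finite alt set \<Rightarrow> 'n alt set set"
  where "orbit p = {act_proj g p | g. invertible g}"

text \<open>
  Since \<open>proj\<close> is a submersion from the nonzero vectors onto \<open>PV\<close>, a function on \<open>PV\<close> is
  differentiable iff its composition with \<open>proj\<close> is, and a curve in \<open>PV\<close> is differentiable iff
  it lifts to a differentiable curve of nonzero vectors. Tangent vectors are the velocities of
  curves, acting on the functions that are differentiable at the given point; they are set to 0
  on all other functions, so that equality of tangent vectors is equality of functionals.
\<close>

definition diff_at :: "('n::finite alt set \<Rightarrow> real) \<Rightarrow> 'n alt set \<Rightarrow> bool"
  where "diff_at f p \<longleftrightarrow> (\<forall>\<mu>\<in>p. (\<lambda>\<nu>. f (proj \<nu>)) differentiable (at \<mu>))"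

definition curve_at :: "(real \<Rightarrow> 'n::finite alt set) \<Rightarrow> 'n alt set \<Rightarrow> bool"
  where "curve_at \<gamma> p \<longleftrightarrow> \<gamma> 0 = p \<and>
    (\<exists>c. c differentiable (at 0) \<and> (\<forall>t. c t \<noteq> 0 \<and> \<gamma> t = proj (c t)))"

type_synonym 'n tangent = "('n alt set \<Rightarrow> real) \<Rightarrow> real"

definition velocity :: "(real \<Rightarrow> 'n::finite alt set) \<Rightarrow> 'n tangent"
  where "velocity \<gamma> = (\<lambda>f. if diff_at f (\<gamma> 0) then deriv (\<lambda>t. f (\<gamma> t)) 0 else 0)"

text \<open>
  The tangent space at \<open>p\<close> of a submanifold \<open>S\<close> of \<open>PV\<close>, as a subspace of that of \<open>PV\<close>. It is
  used for \<open>S = PV\<close> and for the orbits in \<open>PV\<close> of the general linear group, which are embedded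
  submanifolds since the action is algebraic.
\<close>

definition tangent_space :: "'n::finite alt set set \<Rightarrow> 'n alt set \<Rightarrow> 'n tangent set"
  where "tangent_space S p = {velocity \<gamma> | \<gamma>. curve_at \<gamma> p \<and> range \<gamma> \<subseteq> S}"

definition critical_point :: "'n::finite alt set set \<Rightarrow> ('n alt set \<Rightarrow> real) \<Rightarrow> 'n alt set \<Rightarrow> bool"
  where "critical_point S f p \<longleftrightarrow> p \<in> S \<and> diff_at f p \<and> (\<forall>\<xi>\<in>tangent_space S p. \<xi> f = 0)"

definition dproj :: "'n::finite alt \<Rightarrow> 'n alt \<Rightarrow> 'n tangent"
  where "dproj \<mu> v = (\<lambda>f. if diff_at f (proj \<mu>)
    then frechet_derivative (\<lambda>\<nu>. f (proj \<nu>)) (at \<mu>) v else 0)"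

text \<open>
  The horizontal space at a unit vector \<open>\<mu>\<close>: the orthogonal complement, in the tangent space
  \<open>{v. inner v \<mu> = 0}\<close> of the unit sphere, of the kernel of the differential of the restriction
  of \<open>proj\<close> to the sphere.
\<close>

definition horizontal :: "'n::finite alt \<Rightarrow> 'n alt set"
  where "horizontal \<mu> = {v. inner v \<mu> = 0 \<and>
    (\<forall>w. inner w \<mu> = 0 \<and> dproj \<mu> w = (\<lambda>f. 0) \<longrightarrow> inner v w = 0)}"

text \<open>
  The Riemannian submersion condition: at every unit vector, the differential of \<open>proj\<close> maps the
  horizontal space isometrically onto the tangent space of \<open>PV\<close>.
\<close>

definition fubini_study :: "'n::finite alt set \<Rightarrow> 'n tangent \<Rightarrow> 'n tangent \<Rightarrow> real"
  where "fubini_study p \<xi> \<eta> = (THE r. \<exists>\<mu> v w. norm \<mu> = 1 \<and> proj \<mu> = p \<and>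
    v \<in> horizontal \<mu> \<and> w \<in> horizontal \<mu> \<and> dproj \<mu> v = \<xi> \<and> dproj \<mu> w = \<eta> \<and> r = inner v w)"

definition grad :: "('n::finite alt set \<Rightarrow> real) \<Rightarrow> 'n alt set \<Rightarrow> 'n tangent"
  where "grad f p = (THE \<xi>. diff_at f p \<and> \<xi> \<in> tangent_space PV p \<and>
    (\<forall>\<eta>\<in>tangent_space PV p. fubini_study p \<xi> \<eta> = \<eta> f))"

definition rho :: "'n::finite alt \<Rightarrow> complex^'n^'n \<Rightarrow> real"
  where "rho \<mu> g = (norm (act g \<mu>))\<^sup>2"

definition moment :: "'n::finite alt set \<Rightarrow> complex^'n^'n"
  where "moment p = (THE H. hermitian H \<and> (\<forall>\<mu>\<in>p. \<forall>A. hermitian A \<longrightarrow>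
    gl_inner H A = complex_of_real (1 / (norm \<mu>)\<^sup>2 * frechet_derivative (rho \<mu>) (at (mat 1)) A)))"

definition F :: "'n::finite alt set \<Rightarrow> real"
  where "F p = Re (gl_inner (moment p) (moment p))"

end

theory Submission
  imports Defs
begin

text \<open>
  The derivative of the action at the identity in direction \<open>A\<close> is \<open>- delta \<mu> A\<close>, and pairing it with
  \<open>\<mu>\<close> for hermitian \<open>A\<close> gives \<open>(M \<mu>, A) = - 2 \<langle>delta \<mu> A, \<mu>\<rangle>\<close>, whence the moment map. Since \<open>\<mu> \<mapsto> delta \<mu> A\<close>
  is self-adjoint for hermitian \<open>A\<close>, the derivative of \<open>\<nu> \<mapsto> tr (M \<nu>)\<^sup>2\<close> at \<open>\<mu>\<close> is
  \<open>v \<mapsto> - 8 Re \<langle>v, delta \<mu> (M \<mu>)\<rangle>\<close>; the factor \<open>\<parallel>\<nu>\<parallel>\<^sup>-\<^sup>4\<close> does not contribute in horizontal directions, and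
  this is the gradient. Hence \<open>[\<mu>]\<close> is critical iff the horizontal part \<open>h\<close> of \<open>delta \<mu> (M \<mu>)\<close> vanishes. This
  direction is tangent to the orbit, and the derivative of \<open>F\<close> along it is a negative multiple of
  \<open>\<parallel>h\<parallel>\<^sup>2\<close>, so being critical on the orbit suffices. As \<open>delta \<mu> (mat c) = c \<mu>\<close>, the condition \<open>h = 0\<close> says that
  \<open>M \<mu> - mat c\<close> is a derivation for some \<open>c\<close>, which is real because \<open>\<langle>delta \<mu> (M \<mu>), \<mu>\<rangle>\<close> is.
\<close>

subsection \<open>Complex matrices\<close>

lemma has_derivative_vec:
  fixes f :: "'a::real_normed_vector \<Rightarrow> 'b::euclidean_space^'n"
  assumes "\<And>i. ((\<lambda>x. f x $ i) has_derivative (\<lambda>h. f' h $ i)) (at a within S)"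
  shows "(f has_derivative f') (at a within S)"
proof (subst has_derivative_componentwise_within, rule ballI)
  fix b :: "'b^'n" assume "b \<in> Basis"
  then obtain i u where b: "b = axis i u" "u \<in> Basis"
    by (auto simp: Basis_vec_def)
  show "((\<lambda>x. f x \<bullet> b) has_derivative (\<lambda>x. f' x \<bullet> b)) (at a within S)"
    unfolding b inner_axis by (rule has_derivative_inner_left[OF assms])
qed

lemma bounded_bilinear_matrix_mult:
  "bounded_bilinear ((**) :: complex^'k^'n \<Rightarrow> complex^'m^'k \<Rightarrow> complex^'m^'n)"
  unfolding bilinear_conv_bounded_bilinear[symmetric] bilinear_def linear_iff
  by (auto simp: matrix_matrix_mult_def vec_eq_iff sum.distrib scaleR_sum_right distrib_left
      distrib_right)

lemma bounded_bilinear_matrix_vector_mult: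
  "bounded_bilinear ((*v) :: complex^'m^'n \<Rightarrow> complex^'m \<Rightarrow> complex^'n)"
  unfolding bilinear_conv_bounded_bilinear[symmetric] bilinear_def linear_iff
  by (auto simp: matrix_vector_mult_def vec_eq_iff sum.distrib scaleR_sum_right distrib_left
      distrib_right)

lemma adj_add: "adj (A + B) = adj A + adj B"
  and adj_diff: "adj (A - B) = adj A - adj B"
  and adj_scaleR: "adj (r *\<^sub>R A) = r *\<^sub>R adj A"
  by (simp_all add: adj_def vec_eq_iff)

lemma adj_sum: "adj (sum f S) = (\<Sum>x\<in>S. adj (f x))"
  by (induction S rule: infinite_finite_induct) (simp_all add: adj_add, simp_all add: adj_def vec_eq_iff)

lemma bounded_linear_adj: "bounded_linear (adj :: complex^'n^'n \<Rightarrow> complex^'n^'n)"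
  unfolding linear_conv_bounded_linear[symmetric] linear_iff
  by (simp add: adj_add adj_scaleR)

lemmas has_derivative_matrix_mult =
  bounded_bilinear.FDERIV[OF bounded_bilinear_matrix_mult]
lemmas has_derivative_matrix_vector_mult =
  bounded_bilinear.FDERIV[OF bounded_bilinear_matrix_vector_mult]

lemma adj_adj [simp]: "adj (adj A) = A"
  by (simp add: adj_def vec_eq_iff)

lemma adj_nth: "adj A $ i $ j = cnj (A $ j $ i)"
  by (simp add: adj_def)

lemma adj_mult: "adj (A ** B) = adj B ** adj A"
  by (simp add: adj_def matrix_matrix_mult_def vec_eq_iff mult.commute)

lemma gl_inner_sum: "gl_inner A B = (\<Sum>i\<in>UNIV. \<Sum>j\<in>UNIV. A $ i $ j * cnj (B $ i $ j))"
  by (simp add: gl_inner_def trace_def matrix_matrix_mult_def adj_nth)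

lemma Re_gl_inner: "Re (gl_inner A B) = inner A B"
  by (simp add: gl_inner_sum inner_vec_def inner_complex_def)

text \<open>Conjugation transposes both factors, so after swapping the two indices the sum equals
  its own conjugate.\<close>

lemma gl_inner_hermitian:
  assumes "hermitian A" "hermitian B"
  shows "gl_inner A B = complex_of_real (inner A B)"
proof -
  have A: "cnj (A $ i $ j) = A $ j $ i" and B: "cnj (B $ i $ j) = B $ j $ i" for i j
    using assms by (metis adj_nth hermitian_def)+
  have "cnj (gl_inner A B) = (\<Sum>i\<in>UNIV. \<Sum>j\<in>UNIV. A $ j $ i * cnj (B $ j $ i))"
    by (simp add: gl_inner_sum A B)
  also have "\<dots> = gl_inner A B"
    unfolding gl_inner_sum by (rule sum.swap)
  finally have "Im (gl_inner A B) = 0"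
    by (metis complex_cnj_cancel_iff Reals_cnj_iff complex_is_Real_iff)
  then show ?thesis
    by (simp add: complex_eq_iff Re_gl_inner)
qed

text \<open>Testing on \<open>H - K\<close> itself gives norm zero. This supplies the uniqueness
  that \<open>THE\<close> demands in \<open>moment\<close>.\<close>

lemma hermitian_unique:
  assumes "hermitian H" "hermitian K" "\<And>A. hermitian A \<Longrightarrow> gl_inner H A = gl_inner K A"
  shows "H = K"
proof -
  have "hermitian (H - K)"
    using assms by (simp add: hermitian_def adj_diff)
  then have "Re (gl_inner H (H - K)) = Re (gl_inner K (H - K))"
    using assms by simp
  then have "inner (H - K) (H - K) = 0"
    by (simp add: Re_gl_inner inner_diff_left)
  then show ?thesis by simp
qed

lemma hermitian_M: "hermitian (M \<mu>)"
  unfolding hermitian_def M_def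
  by (simp only: adj_add adj_scaleR adj_sum adj_mult adj_adj)

lemma hermitian_scaleR: "hermitian A \<Longrightarrow> hermitian (r *\<^sub>R A)"
  by (simp add: hermitian_def adj_scaleR)

section \<open>Inversion of matrices near the identity\<close>

lemma invertible_mat_1: "invertible (mat 1 :: complex^'n^'n)"
  unfolding invertible_def by (intro exI[of _ "mat 1"]) simp

lemma matrix_inv_mult_left:
  fixes g :: "complex^'n^'n"
  assumes "invertible g"
  shows "matrix_inv g ** g = mat 1"
  using someI_ex[OF assms[unfolded invertible_def]] by (simp add: matrix_inv_def)

lemma matrix_inv_mat_1 [simp]: "matrix_inv (mat 1 :: complex^'n^'n) = mat 1"
  using matrix_inv_mult_left[OF invertible_mat_1] by simp

lemma matrix_inv_mat_1_add:
  fixes A :: "complex^'n^'n"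
  assumes "invertible (mat 1 + A)"
  shows "matrix_inv (mat 1 + A) = mat 1 - matrix_inv (mat 1 + A) ** A"
proof -
  have "matrix_inv (mat 1 + A) ** (mat 1 + A) = mat 1"
    by (rule matrix_inv_mult_left[OF assms])
  then show ?thesis
    by (simp add: matrix_add_ldistrib eq_diff_eq)
qed

text \<open>A kernel vector \<open>x\<close> of \<open>g\<close> satisfies
  \<open>(g - mat 1) *v x = - x\<close>. For nonzero \<open>x\<close> this contradicts the bound
  \<open>K\<close> of the matrix-vector product once \<open>g\<close> is close to the
  identity.\<close>

lemma eventually_invertible:
  "eventually (\<lambda>g :: complex^'n^'n. invertible g) (at (mat 1))"
proof -
  obtain K where K: "K > 0" "\<And>(A::complex^'n^'n) x. norm (A *v x) \<le> norm A * norm x * K"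
    using bounded_bilinear.pos_bounded[OF bounded_bilinear_matrix_vector_mult] by metis
  have "invertible g" if "dist g (mat 1) < 1 / K" for g :: "complex^'n^'n"
  proof -
    have "x = 0" if x: "g *v x = 0" for x
    proof (rule ccontr)
      assume "x \<noteq> 0"
      have "(g - mat 1) *v x = - x"
        using x by (simp add: matrix_vector_mult_diff_rdistrib)
      then have "norm x \<le> norm (g - mat 1) * norm x * K"
        using K(2)[of "g - mat 1" x] by simp
      also have "\<dots> < 1 / K * norm x * K"
        using \<open>dist g (mat 1) < 1 / K\<close> \<open>x \<noteq> 0\<close> K(1)
        by (intro mult_strict_right_mono) (auto simp: dist_norm)
      finally show False using K(1) by simp
    qed
    then show ?thesis
      using invertible_left_inverse matrix_left_invertible_ker by blast
  qed
  then show ?thesis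
    using K(1) by (auto simp: eventually_at intro!: exI[of _ "1 / K"])
qed

text \<open>Let \<open>h\<close> be \<open>g - mat 1\<close> and \<open>i\<close> the inverse of
  \<open>g\<close>. Applying \<open>i = 1 - i h\<close> twice gives
  \<open>i - 1 + h = i h h\<close>, so the remainder is quadratic in \<open>h\<close> as long as
  \<open>i\<close> stays bounded.\<close>

lemma has_derivative_matrix_inv:
  "((matrix_inv :: complex^'n^'n \<Rightarrow> complex^'n^'n) has_derivative (\<lambda>A. - A)) (at (mat 1))"
proof -
  let ?i = "matrix_inv :: complex^'n^'n \<Rightarrow> complex^'n^'n"
  let ?I = "mat 1 :: complex^'n^'n"
  obtain K where K: "K > 0" "\<And>(A :: complex^'n^'n) (B :: complex^'n^'n). norm (A ** B) \<le> norm A * norm B * K"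
    using bounded_bilinear.pos_bounded[OF bounded_bilinear_matrix_mult] by metis
  have bound: "norm (?i g - ?I + (g - ?I)) / norm (g - ?I) \<le>
      2 * norm ?I * K * K * norm (g - ?I)"
    if "invertible g" "norm (g - ?I) \<le> 1 / (2 * K)" for g
  proof -
    define h where "h = g - ?I"
    have g: "g = ?I + h" by (simp add: h_def)
    have i: "?i g = ?I - ?i g ** h"
      using matrix_inv_mat_1_add[of h] that(1) g by simp
    have "?i g ** h = ?I - ?i g"
      using i by (simp add: eq_diff_eq add.commute)
    then have "(?i g ** h) ** h = h - ?i g ** h"
      by (simp add: bounded_bilinear.diff_left[OF bounded_bilinear_matrix_mult])
    also have "\<dots> = ?i g - ?I + h"
      using i by (simp add: algebra_simps)
    finally have eq: "?i g - ?I + h = (?i g ** h) ** h" ..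
    \<comment> \<open>At distance at most \<open>1 / (2 * K)\<close> the bound on the norm of
      \<open>?i g ** h\<close> is half the norm of \<open>?i g\<close>, so it can be absorbed on the
      left.\<close>
    have "norm (?i g) \<le> 2 * norm ?I"
    proof -
      have "norm (?i g) \<le> norm ?I + norm (?i g ** h)"
        using norm_triangle_ineq4[of ?I "?i g ** h"] i by simp
      also have "norm (?i g ** h) \<le> norm (?i g) * norm h * K"
        using K(2)[of "?i g" h] by simp
      also have "\<dots> \<le> norm (?i g) * (1 / (2 * K)) * K"
        using that(2) K(1) by (intro mult_left_mono mult_right_mono) (auto simp: h_def)
      finally show ?thesis using K(1) by simp
    qed
    then have "norm (?i g) * norm h * K \<le> 2 * norm ?I * norm h * K"
      using K(1) by (intro mult_right_mono) auto
    then have "norm (?i g ** h) \<le> 2 * norm ?I * norm h * K"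
      using K(2)[of "?i g" h] by linarith
    then have "norm (?i g ** h) * norm h * K \<le> (2 * norm ?I * norm h * K) * norm h * K"
      using K(1) by (intro mult_right_mono) auto
    then have "norm (?i g - ?I + h) \<le> (2 * norm ?I * norm h * K) * norm h * K"
      using K(2)[of "?i g ** h" h] eq by simp
    then show ?thesis
      unfolding h_def[symmetric]
      by (cases "h = 0") (auto simp: field_simps)
  qed
  have ev: "\<forall>\<^sub>F g in at ?I. norm (?i g - ?I + (g - ?I)) / norm (g - ?I) \<le>
      2 * norm ?I * K * K * norm (g - ?I)"
  proof -
    have "\<forall>\<^sub>F g in at ?I. norm (g - ?I) \<le> 1 / (2 * K)"
      using K(1) by (auto simp: eventually_at dist_norm intro!: exI[of _ "1 / (2 * K)"])
    with eventually_invertible show ?thesis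
      by eventually_elim (use bound in blast)
  qed
  have "((\<lambda>g. 2 * norm ?I * K * K * norm (g - ?I)) \<longlongrightarrow> 2 * norm ?I * K * K * norm (?I - ?I)) (at ?I)"
    by (intro tendsto_intros)
  then have "((\<lambda>g. norm (?i g - ?I + (g - ?I)) / norm (g - ?I)) \<longlongrightarrow> 0) (at ?I)"
    by (intro tendsto_sandwich[OF _ ev tendsto_const]) auto
  then show ?thesis
    by (simp add: has_derivative_iff_norm bounded_linear_minus[OF bounded_linear_ident])
qed

subsection \<open>Alternating bilinear maps\<close>

lemma app_add_left: "app \<mu> (X + Y) Z = app \<mu> X Z + app \<mu> Y Z"
  and app_add_right: "app \<mu> X (Y + Z) = app \<mu> X Y + app \<mu> X Z"
  and app_scale_left: "app \<mu> (c *s X) Y = c *s app \<mu> X Y"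
  and app_scale_right: "app \<mu> X (c *s Y) = c *s app \<mu> X Y"
  using app[of \<mu>] by (auto simp: alt_bilinear_iff)

lemma app_anti: "app \<mu> X Y = - app \<mu> Y X"
  using alt_bilinear_anti[of "app \<mu>" X Y] app[of \<mu>] by (simp add: eq_neg_iff_add_eq_0)

lemma app_sum_left: "app \<mu> (sum f S) Y = (\<Sum>x\<in>S. app \<mu> (f x) Y)"
  \<comment> \<open>With scalar 0 this says that \<open>app \<mu>\<close> vanishes at 0, as the
    empty and the infinite sum require.\<close>
  using app_scale_left[of \<mu> 0 0 Y]
  by (induction S rule: infinite_finite_induct) (simp_all add: app_add_left)

lemma app_sum_right: "app \<mu> X (sum f S) = (\<Sum>x\<in>S. app \<mu> X (f x))"
  using app_scale_right[of \<mu> X 0 0]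
  by (induction S rule: infinite_finite_induct) (simp_all add: app_add_right)

lemma bounded_bilinear_app: "bounded_bilinear (app \<mu>)"
proof -
  have "r *\<^sub>R x = complex_of_real r *s x" for r and x :: "complex^'a"
    by (simp add: vec_eq_iff scaleR_conv_of_real[where 'a=complex])
  then show ?thesis
    unfolding bilinear_conv_bounded_bilinear[symmetric] bilinear_def linear_iff
    by (simp add: app_add_left app_add_right app_scale_left app_scale_right)
qed

lemma matrix_vector_axis: "A *v axis i 1 = (\<Sum>l\<in>UNIV. A $ l $ i *s axis l (1::complex))"
  by (simp add: matrix_vector_mult_def vec_eq_iff axis_def if_distrib[of "(*) _"] cong: if_cong)

lemma app_delta_axis:
  "app (delta \<mu> A) (axis i 1) (axis j 1) $ k =
    (\<Sum>l\<in>UNIV. A $ l $ i * app \<mu> (axis l 1) (axis j 1) $ k) +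
    (\<Sum>l\<in>UNIV. A $ l $ j * app \<mu> (axis i 1) (axis l 1) $ k) -
    (\<Sum>l\<in>UNIV. A $ k $ l * app \<mu> (axis i 1) (axis j 1) $ l)"
  by (simp add: delta.rep_eq matrix_vector_axis app_sum_left app_sum_right app_scale_left
      app_scale_right) (simp add: matrix_vector_mult_def)

lemma ad_nth: "ad \<mu> X $ k $ j = app \<mu> X (axis j 1) $ k"
  by (simp add: ad_def matrix_def)

lemma M_nth:
  "M \<mu> $ k $ l =
    (\<Sum>i\<in>UNIV. \<Sum>j\<in>UNIV. - 4 *
      (cnj (app \<mu> (axis i 1) (axis k 1) $ j) * app \<mu> (axis i 1) (axis l 1) $ j)) +
    (\<Sum>i\<in>UNIV. \<Sum>j\<in>UNIV. 2 *
      (app \<mu> (axis i 1) (axis j 1) $ k * cnj (app \<mu> (axis i 1) (axis j 1) $ l)))"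
  by (simp add: M_def matrix_matrix_mult_def adj_nth ad_nth scaleR_conv_of_real
      sum_distrib_left sum_negf)

lemma herm_alt_sum:
  "herm_alt \<mu> \<nu> = (\<Sum>i\<in>UNIV. \<Sum>j\<in>UNIV. \<Sum>k\<in>UNIV.
    app \<mu> (axis i 1) (axis j 1) $ k * cnj (app \<nu> (axis i 1) (axis j 1) $ k))"
  by (simp add: herm_alt_def herm_axis)

lemma alt_eqI:
  assumes "\<And>i j. app \<mu> (axis i 1) (axis j 1) = app \<nu> (axis i 1) (axis j 1)"
  shows "\<mu> = \<nu>"
  using app_eq_0I[of "\<mu> - \<nu>"] assms by (simp add: minus_alt.rep_eq)

lemma herm_alt_add_left: "herm_alt (\<mu> + \<nu>) \<kappa> = herm_alt \<mu> \<kappa> + herm_alt \<nu> \<kappa>"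
  and herm_alt_add_right: "herm_alt \<kappa> (\<mu> + \<nu>) = herm_alt \<kappa> \<mu> + herm_alt \<kappa> \<nu>"
  and herm_alt_cscale_left: "herm_alt (cscale c \<mu>) \<kappa> = c * herm_alt \<mu> \<kappa>"
  and herm_alt_cscale_right: "herm_alt \<kappa> (cscale c \<mu>) = cnj c * herm_alt \<kappa> \<mu>"
  by (simp_all add: herm_alt_sum plus_alt.rep_eq cscale.rep_eq sum.distrib sum_distrib_left
      algebra_simps)

lemma herm_alt_commute: "herm_alt \<nu> \<mu> = cnj (herm_alt \<mu> \<nu>)"
  by (simp add: herm_alt_sum mult.commute)

lemma Re_herm_alt: "Re (herm_alt \<mu> \<nu>) = inner \<mu> \<nu>"
  by (simp add: inner_alt_def)

lemma herm_alt_self: "herm_alt \<mu> \<mu> = complex_of_real ((norm \<mu>)\<^sup>2)"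
proof -
  have "Im (herm_alt \<mu> \<mu>) = 0"
    using herm_alt_commute[of \<mu> \<mu>] by (simp add: complex_eq_iff)
  then show ?thesis
    by (simp add: complex_eq_iff Re_herm_alt power2_norm_eq_inner)
qed

lemma cscale_1 [simp]: "cscale 1 \<mu> = \<mu>"
  and cscale_0 [simp]: "cscale 0 \<mu> = 0"
  and cscale_cscale [simp]: "cscale c (cscale d \<mu>) = cscale (c * d) \<mu>"
  and cscale_add: "cscale c (\<mu> + \<nu>) = cscale c \<mu> + cscale c \<nu>"
  and cscale_of_real: "cscale (complex_of_real r) \<mu> = r *\<^sub>R \<mu>"
  by (intro alt_eqI; simp add: cscale.rep_eq plus_alt.rep_eq zero_alt.rep_eq scaleR_alt_def
      vector_add_ldistrib)+

lemma norm_cscale: "norm (cscale c \<mu>) = cmod c * norm \<mu>"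
proof -
  have "complex_of_real ((norm (cscale c \<mu>))\<^sup>2) = (c * cnj c) * complex_of_real ((norm \<mu>)\<^sup>2)"
    unfolding herm_alt_self[symmetric]
    by (simp add: herm_alt_cscale_left herm_alt_cscale_right)
  also have "\<dots> = complex_of_real ((cmod c * norm \<mu>)\<^sup>2)"
    by (simp only: complex_norm_square[symmetric] of_real_mult power_mult_distrib)
  finally have "(norm (cscale c \<mu>))\<^sup>2 = (cmod c * norm \<mu>)\<^sup>2"
    by (simp only: of_real_eq_iff)
  then show ?thesis by simp
qed

lemma cscale_eq_0_iff [simp]: "cscale c \<mu> = 0 \<longleftrightarrow> c = 0 \<or> \<mu> = 0"
  by (metis norm_cscale norm_eq_zero mult_eq_0_iff)

text \<open>For a scalar matrix the two arguments contribute \<open>c\<close> each and the value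
  takes one away. This is how the radial direction is matched with multiples of the
  identity.\<close>

lemma delta_add: "delta (\<mu> + \<nu>) A = delta \<mu> A + delta \<nu> A"
  and delta_cscale: "delta (cscale c \<mu>) A = cscale c (delta \<mu> A)"
  and delta_diff_right: "delta \<mu> (A - B) = delta \<mu> A - delta \<mu> B"
  and delta_mat: "delta \<mu> (mat c) = cscale c \<mu>"
proof -
  show "delta \<mu> (mat c) = cscale c \<mu>"
  proof -
    have "mat c *v x = c *s x" for x :: "complex^'a"
      by (simp add: mat_def matrix_vector_mult_def vec_eq_iff if_distrib[of "\<lambda>x. x * _"]
          cong: if_cong)
    then show ?thesis
      by (intro alt_eqI) (simp add: delta.rep_eq cscale.rep_eq app_scale_left app_scale_right)
  qed
qed (intro alt_eqI; simp add: app_delta_axis vec_eq_iff plus_alt.rep_eq minus_alt.rep_eq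
    cscale.rep_eq sum.distrib sum_subtractf sum_distrib_left algebra_simps)+

subsection \<open>The infinitesimal action\<close>

text \<open>In structure constants \<open>herm_alt (delta \<mu> A) \<mu>\<close> is
  \<open>2 * S1 - S2\<close>, where \<open>S1\<close> comes from \<open>A\<close> in one argument
  and \<open>S2\<close> from \<open>A\<close> applied to the value. The coefficients -4 and 2 of
  \<open>M\<close> are -2 times these; as \<open>A\<close> is hermitian, its conjugated entries in
  \<open>gl_inner\<close> are transposed entries.\<close>

lemma gl_inner_M:
  assumes "hermitian A"
  shows "gl_inner (M \<mu>) A = - 2 * herm_alt (delta \<mu> A) \<mu>"
proof -
  define c where "c i j k = app \<mu> (axis i 1) (axis j 1) $ k" for i j k
  have anti: "c i j k = - c j i k" for i j k
    unfolding c_def by (subst app_anti) simp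
  have A: "cnj (A $ i $ j) = A $ j $ i" for i j
    using assms by (metis adj_nth hermitian_def)
  define S1 where "S1 = (\<Sum>i\<in>UNIV. \<Sum>j\<in>UNIV. \<Sum>k\<in>UNIV. \<Sum>l\<in>UNIV. A $ l $ j * c i l k * cnj (c i j k))"
  define S2 where "S2 = (\<Sum>i\<in>UNIV. \<Sum>j\<in>UNIV. \<Sum>k\<in>UNIV. \<Sum>l\<in>UNIV. A $ k $ l * c i j l * cnj (c i j k))"
  \<comment> \<open>Exchanging the arguments in both factors costs two signs, which cancel. So
    \<open>A\<close> in the first argument contributes the same as \<open>A\<close> in the
    second.\<close>
  have "(\<Sum>i\<in>UNIV. \<Sum>j\<in>UNIV. \<Sum>k\<in>UNIV. \<Sum>l\<in>UNIV. A $ l $ i * c l j k * cnj (c i j k)) =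
      (\<Sum>i\<in>UNIV. \<Sum>j\<in>UNIV. \<Sum>k\<in>UNIV. \<Sum>l\<in>UNIV. A $ l $ i * c j l k * cnj (c j i k))"
  proof (intro sum.cong refl)
    fix i j k l
    show "A $ l $ i * c l j k * cnj (c i j k) = A $ l $ i * c j l k * cnj (c j i k)"
      by (subst anti[of l j], subst anti[of i j]) simp
  qed
  also have "\<dots> = S1"
    unfolding S1_def by (rule sum.swap)
  finally have "herm_alt (delta \<mu> A) \<mu> = S1 + S1 - S2"
    by (simp add: herm_alt_sum app_delta_axis S1_def S2_def c_def[symmetric] sum.distrib
        sum_subtractf distrib_right left_diff_distrib sum_distrib_right)
  moreover have "(\<Sum>k\<in>UNIV. \<Sum>l\<in>UNIV. \<Sum>i\<in>UNIV. \<Sum>j\<in>UNIV. A $ l $ k * c i l j * cnj (c i k j)) = S1"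
  proof -
    have "(\<Sum>k\<in>UNIV. \<Sum>l\<in>UNIV. \<Sum>i\<in>UNIV. \<Sum>j\<in>UNIV. A $ l $ k * c i l j * cnj (c i k j)) =
      (\<Sum>k\<in>UNIV. \<Sum>i\<in>UNIV. \<Sum>l\<in>UNIV. \<Sum>j\<in>UNIV. A $ l $ k * c i l j * cnj (c i k j))"
      by (rule sum.cong[OF refl], rule sum.swap)
    also have "\<dots> = (\<Sum>i\<in>UNIV. \<Sum>k\<in>UNIV. \<Sum>l\<in>UNIV. \<Sum>j\<in>UNIV. A $ l $ k * c i l j * cnj (c i k j))"
      by (rule sum.swap)
    also have "\<dots> = S1"
      unfolding S1_def by (rule sum.cong[OF refl], rule sum.cong[OF refl], rule sum.swap)
    finally show ?thesis .
  qed
  moreover have "(\<Sum>k\<in>UNIV. \<Sum>l\<in>UNIV. \<Sum>i\<in>UNIV. \<Sum>j\<in>UNIV. A $ l $ k * c i j k * cnj (c i j l)) = S2"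
  proof -
    have "(\<Sum>k\<in>UNIV. \<Sum>l\<in>UNIV. \<Sum>i\<in>UNIV. \<Sum>j\<in>UNIV. A $ l $ k * c i j k * cnj (c i j l)) =
      (\<Sum>k\<in>UNIV. \<Sum>i\<in>UNIV. \<Sum>l\<in>UNIV. \<Sum>j\<in>UNIV. A $ l $ k * c i j k * cnj (c i j l))"
      by (rule sum.cong[OF refl], rule sum.swap)
    also have "\<dots> = (\<Sum>i\<in>UNIV. \<Sum>k\<in>UNIV. \<Sum>l\<in>UNIV. \<Sum>j\<in>UNIV. A $ l $ k * c i j k * cnj (c i j l))"
      by (rule sum.swap)
    also have "\<dots> = (\<Sum>i\<in>UNIV. \<Sum>k\<in>UNIV. \<Sum>j\<in>UNIV. \<Sum>l\<in>UNIV. A $ l $ k * c i j k * cnj (c i j l))"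
      by (rule sum.cong[OF refl], rule sum.cong[OF refl], rule sum.swap)
    also have "\<dots> = (\<Sum>i\<in>UNIV. \<Sum>j\<in>UNIV. \<Sum>k\<in>UNIV. \<Sum>l\<in>UNIV. A $ l $ k * c i j k * cnj (c i j l))"
      by (rule sum.cong[OF refl], rule sum.swap)
    also have "\<dots> = S2"
      unfolding S2_def by (rule sum.cong[OF refl], rule sum.cong[OF refl], rule sum.swap)
    finally show ?thesis .
  qed
  moreover have "gl_inner (M \<mu>) A =
    - 4 * (\<Sum>k\<in>UNIV. \<Sum>l\<in>UNIV. \<Sum>i\<in>UNIV. \<Sum>j\<in>UNIV. A $ l $ k * c i l j * cnj (c i k j)) +
      2 * (\<Sum>k\<in>UNIV. \<Sum>l\<in>UNIV. \<Sum>i\<in>UNIV. \<Sum>j\<in>UNIV. A $ l $ k * c i j k * cnj (c i j l))"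
  proof -
    have "M \<mu> $ k $ l * cnj (A $ k $ l) =
        - 4 * (\<Sum>i\<in>UNIV. \<Sum>j\<in>UNIV. A $ l $ k * c i l j * cnj (c i k j)) +
        2 * (\<Sum>i\<in>UNIV. \<Sum>j\<in>UNIV. A $ l $ k * c i j k * cnj (c i j l))" for k l
      unfolding M_nth c_def[symmetric] A distrib_right
      by (simp only: sum_distrib_left sum_distrib_right mult_ac)
    then show ?thesis
      by (simp only: gl_inner_sum sum.distrib sum_distrib_left)
  qed
  ultimately show ?thesis by simp
qed

text \<open>For fixed \<open>A\<close> the right side is quadratic in \<open>\<mu>\<close>. It
  serves to identify the moment map and also to differentiate \<open>M\<close> against a fixed
  hermitian matrix.\<close>

lemma inner_M: "hermitian A \<Longrightarrow> inner (M \<mu>) A = - 2 * inner \<mu> (delta \<mu> A)"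
  using arg_cong[OF gl_inner_M[of A \<mu>], of Re]
  by (simp add: Re_gl_inner Re_herm_alt inner_commute)

text \<open>By \<open>gl_inner_M\<close> the left side is a real multiple of a pairing of two
  hermitian matrices, which is real.\<close>

lemma herm_alt_delta_self:
  assumes "hermitian A"
  shows "herm_alt (delta \<mu> A) \<mu> = complex_of_real (inner (delta \<mu> A) \<mu>)"
  using gl_inner_M[OF assms, of \<mu>] gl_inner_hermitian[OF hermitian_M assms, of \<mu>] inner_M[OF assms, of \<mu>]
  by (simp add: inner_commute complex_eq_iff)

text \<open>A sesquilinear form with real values on the diagonal is hermitian.\<close>

lemma inner_delta:
  assumes "hermitian A"
  shows "inner (delta \<mu> A) \<nu> = inner \<mu> (delta \<nu> A)"
proof -
  have "Im (herm_alt (delta \<mu> A) \<mu>) = 0" for \<mu>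
    using herm_alt_delta_self[OF assms, of \<mu>] by simp
  \<comment> \<open>Expanding at this sum, the factor \<open>\<i>\<close> turns the imaginary parts
    of the cross terms into real parts of opposite signs.\<close>
  from this[of "\<mu> + cscale \<i> \<nu>"] this[of \<mu>] this[of "\<nu>"]
  have "Re (herm_alt (delta \<mu> A) \<nu>) = Re (herm_alt (delta \<nu> A) \<mu>)"
    by (simp add: delta_add delta_cscale herm_alt_add_left herm_alt_add_right
        herm_alt_cscale_left herm_alt_cscale_right)
  then show ?thesis by (simp add: Re_herm_alt inner_commute)
qed

text \<open>\<open>'n alt\<close> is not an instance of \<open>euclidean_space\<close>; finite dimensionality is brought in
  through this isometric embedding.\<close>

definition coeffs :: "'n::finite alt \<Rightarrow> complex^'n^'n^'n"
  where "coeffs \<mu> = (\<chi> i j. app \<mu> (axis i 1) (axis j 1))"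

lemma linear_coeffs: "linear coeffs"
  by (simp add: linear_iff coeffs_def vec_eq_iff plus_alt.rep_eq scaleR_alt_def cscale.rep_eq
      scaleR_conv_of_real[where 'a=complex])

lemma norm_coeffs: "norm (coeffs \<mu>) = norm \<mu>"
  by (simp add: norm_eq_sqrt_inner inner_alt_sum coeffs_def inner_vec_def)

lemma bounded_linear_coeffs: "bounded_linear coeffs"
  by (intro bounded_linear_intro[where K = 1])
    (simp_all add: linear_coeffs[unfolded linear_iff] norm_coeffs)

lemma coeffs_left_inverse:
  obtains g :: "complex^'n^'n^'n \<Rightarrow> 'n::finite alt" where "linear g" "\<And>\<mu>. g (coeffs \<mu>) = \<mu>"
proof -
  have "inj (coeffs :: 'n alt \<Rightarrow> _)"
    by (auto simp: inj_def coeffs_def vec_eq_iff intro!: alt_eqI)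
  from linear_injective_left_inverse[OF linear_coeffs this] show ?thesis
    using that by (auto simp: fun_eq_iff)
qed

text \<open>\<open>f\<close> factors through \<open>coeffs\<close> and a linear map on a euclidean
  space, where linearity implies boundedness.\<close>

lemma bounded_linear_alt:
  fixes f :: "'n::finite alt \<Rightarrow> 'b::real_normed_vector"
  assumes "linear f"
  shows "bounded_linear f"
proof -
  obtain g :: "complex^'n^'n^'n \<Rightarrow> 'n alt" where g: "linear g" "\<And>\<mu>. g (coeffs \<mu>) = \<mu>"
    by (rule coeffs_left_inverse) blast
  have "bounded_linear (\<lambda>x. f (g x))"
    using linear_compose[OF g(1) assms] by (simp add: o_def linear_conv_bounded_linear)
  from bounded_linear_compose[OF this bounded_linear_coeffs] show ?thesis
    by (simp add: g)
qed

text \<open>The entries of \<open>coeffs\<close> are differentiated one by one, and the linear left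
  inverse carries the result back.\<close>

lemma has_derivative_alt:
  fixes f :: "'a::real_normed_vector \<Rightarrow> 'n::finite alt"
  assumes "\<And>i j. ((\<lambda>x. app (f x) (axis i 1) (axis j 1)) has_derivative
    (\<lambda>h. app (f' h) (axis i 1) (axis j 1))) (at a within S)"
  shows "(f has_derivative f') (at a within S)"
proof -
  obtain g :: "complex^'n^'n^'n \<Rightarrow> 'n alt" where g: "linear g" "\<And>\<mu>. g (coeffs \<mu>) = \<mu>"
    by (rule coeffs_left_inverse) blast
  have "((\<lambda>x. coeffs (f x)) has_derivative (\<lambda>h. coeffs (f' h))) (at a within S)"
    by (rule has_derivative_vec, rule has_derivative_vec) (simp add: coeffs_def assms)
  from bounded_linear.has_derivative[OF g(1)[unfolded linear_conv_bounded_linear] this]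
  show ?thesis by (simp add: g)
qed

lemma bounded_linear_cscale: "bounded_linear (cscale c)"
  by (rule bounded_linear_alt)
    (simp add: linear_iff cscale_add cscale_of_real[symmetric] mult.commute)

lemma bounded_linear_herm_alt: "bounded_linear (\<lambda>\<mu>. herm_alt \<mu> \<nu>)"
  by (rule bounded_linear_alt)
    (simp add: linear_iff herm_alt_add_left cscale_of_real[symmetric] herm_alt_cscale_left
      scaleR_conv_of_real)

lemma bounded_linear_ad: "bounded_linear (\<lambda>\<mu>. ad \<mu> X)"
  by (rule bounded_linear_alt)
    (simp add: linear_iff ad_nth vec_eq_iff plus_alt.rep_eq scaleR_alt_def cscale.rep_eq
      scaleR_conv_of_real[where 'a=complex])

lemma bounded_linear_delta: "bounded_linear (\<lambda>\<mu>. delta \<mu> A)"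
  by (rule bounded_linear_alt)
    (simp add: linear_iff delta_add cscale_of_real[symmetric] delta_cscale)

text \<open>In the product rule each inverse contributes \<open>- A\<close>, so the three terms are
  those of \<open>delta \<mu> A\<close> with opposite signs.\<close>

lemma has_derivative_act:
  "((\<lambda>g. act g \<mu>) has_derivative (\<lambda>A. - delta \<mu> A)) (at (mat 1))"
proof (rule has_derivative_alt)
  fix i j
  have inv: "((\<lambda>g :: complex^'a^'a. matrix_inv g *v x) has_derivative (\<lambda>A. - (A *v x))) (at (mat 1))"
    for x
    by (rule has_derivative_eq_rhs[OF has_derivative_matrix_vector_mult[OF
            has_derivative_matrix_inv has_derivative_const]])
      (simp add: fun_eq_iff matrix_vector_mult_def sum_negf vec_eq_iff)
  interpret a: bounded_bilinear "app \<mu>" by (rule bounded_bilinear_app)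
  show "((\<lambda>g. app (act g \<mu>) (axis i 1) (axis j 1)) has_derivative
      (\<lambda>A. app (- delta \<mu> A) (axis i 1) (axis j 1))) (at (mat 1))"
    unfolding act.rep_eq uminus_alt.rep_eq delta.rep_eq
    by (rule has_derivative_eq_rhs[OF has_derivative_matrix_vector_mult[OF has_derivative_ident
          a.FDERIV[OF inv inv]]])
      (simp add: fun_eq_iff a.minus_left a.minus_right)
qed

lemma act_mat_1 [simp]: "act (mat 1) \<mu> = \<mu>"
  by (rule alt_eqI) (simp add: act.rep_eq)

lemma has_derivative_rho:
  "(rho \<mu> has_derivative (\<lambda>A. - 2 * inner \<mu> (delta \<mu> A))) (at (mat 1))"
  unfolding rho_def power2_norm_eq_inner
  by (rule has_derivative_eq_rhs[OF has_derivative_inner[OF has_derivative_act has_derivative_act]])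
    (simp add: fun_eq_iff inner_commute)

lemma M_cscale: "M (cscale c \<mu>) = (cmod c)\<^sup>2 *\<^sub>R M \<mu>"
  by (simp add: vec_eq_iff M_nth cscale.rep_eq scaleR_conv_of_real[where 'a=complex]
      complex_norm_square sum_distrib_left distrib_left mult_ac del: of_real_power)

text \<open>Existence of a derivative suffices, as its pairing with \<open>M \<mu>\<close> is found
  later from \<open>inner_M\<close>. It is left schematic by \<open>exI\<close> and filled in by the
  rules.\<close>

lemma M_differentiable: "M differentiable (at \<mu>)"
  unfolding differentiable_def M_def[abs_def]
  by (rule exI, (rule has_derivative_add has_derivative_scaleR_right has_derivative_sum
    has_derivative_matrix_mult bounded_linear.has_derivative[OF bounded_linear_adj]
    bounded_linear_imp_has_derivative bounded_linear_ad)+)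

subsection \<open>Differential geometry of the projective space\<close>

lemma self_in_proj: "\<mu> \<in> proj \<mu>"
  unfolding proj_def by (rule CollectI, rule exI[of _ 1]) simp

lemma in_projE:
  assumes "\<nu> \<in> proj \<mu>"
  obtains c where "c \<noteq> 0" "\<nu> = cscale c \<mu>"
  using assms unfolding proj_def by blast

lemma proj_cscale:
  assumes "c \<noteq> 0"
  shows "proj (cscale c \<mu>) = proj \<mu>"
proof -
  have "proj (cscale a \<nu>) \<subseteq> proj \<nu>" if "a \<noteq> 0" for a and \<nu> :: "'a alt"
  proof
    fix \<kappa> assume "\<kappa> \<in> proj (cscale a \<nu>)"
    then obtain d where "d \<noteq> 0" "\<kappa> = cscale (d * a) \<nu>"
      by (auto simp: proj_def)
    then show "\<kappa> \<in> proj \<nu>"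
      using that unfolding proj_def by (intro CollectI exI[of _ "d * a"]) simp
  qed
  from this[OF assms, of \<mu>] this[of "1 / c" "cscale c \<mu>"] assms show ?thesis
    by auto
qed

lemma proj_eqD:
  assumes "proj \<nu> = proj \<mu>"
  obtains c where "c \<noteq> 0" "\<nu> = cscale c \<mu>"
proof -
  have "\<nu> \<in> proj \<mu>"
    using self_in_proj[of \<nu>] assms by simp
  then show ?thesis
    using that by (rule in_projE)
qed

lemma moment_proj:
  assumes "\<mu> \<noteq> 0"
  shows "moment (proj \<mu>) = (1 / (norm \<mu>)\<^sup>2) *\<^sub>R M \<mu>"
proof -
  let ?H = "(1 / (norm \<mu>)\<^sup>2) *\<^sub>R M \<mu>"
  have frechet: "frechet_derivative (rho \<nu>) (at (mat 1)) A = inner (M \<nu>) A"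
    if "hermitian A" for \<nu> :: "'a alt" and A
    using inner_M[OF that, of \<nu>] frechet_derivative_at[OF has_derivative_rho[of \<nu>]]
    by (simp add: fun_eq_iff)
  have H: "hermitian ?H"
    by (rule hermitian_scaleR[OF hermitian_M])
  \<comment> \<open>\<open>moment\<close> constrains its value at every representative; a factor
    \<open>c\<close> multiplies \<open>M\<close> and the squared norm alike by
    \<open>(cmod c)\<^sup>2\<close>.\<close>
  have H': "gl_inner ?H A = complex_of_real (1 / (norm \<nu>)\<^sup>2 * frechet_derivative (rho \<nu>) (at (mat 1)) A)"
    if \<nu>: "\<nu> \<in> proj \<mu>" and A: "hermitian A" for \<nu> A
  proof -
    obtain c where c: "c \<noteq> 0" "\<nu> = cscale c \<mu>"
      by (rule in_projE[OF \<nu>])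
    have "gl_inner ?H A = complex_of_real (inner ?H A)"
      by (rule gl_inner_hermitian[OF H A])
    also have "inner ?H A = 1 / (norm \<nu>)\<^sup>2 * inner (M \<nu>) A"
      using c(1) by (simp only: c(2) M_cscale norm_cscale power_mult_distrib inner_scaleR_left) simp
    finally show ?thesis
      by (simp only: frechet[OF A])
  qed
  show ?thesis
    unfolding moment_def
  proof (rule the_equality)
    fix K
    assume K: "hermitian K \<and> (\<forall>\<nu>\<in>proj \<mu>. \<forall>A. hermitian A \<longrightarrow>
      gl_inner K A = complex_of_real (1 / (norm \<nu>)\<^sup>2 * frechet_derivative (rho \<nu>) (at (mat 1)) A))"
    show "K = ?H"
    proof (rule hermitian_unique)
      show "hermitian K" using K by blast
      show "hermitian ?H" by (rule H)
      show "gl_inner K A = gl_inner ?H A" if "hermitian A" for A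
        using H'[OF self_in_proj that] K[THEN conjunct2, rule_format, OF self_in_proj that]
        by (simp only:)
    qed
  qed (intro conjI ballI allI impI H H')
qed

lemma F_proj: "\<mu> \<noteq> 0 \<Longrightarrow> F (proj \<mu>) = inner (M \<mu>) (M \<mu>) / (inner \<mu> \<mu>)\<^sup>2"
  by (simp add: F_def Re_gl_inner moment_proj dot_square_norm power2_eq_square)

text \<open>Quotient rule for the expression in \<open>F_proj\<close>. The second term is radial: it
  vanishes on vectors orthogonal to \<open>\<mu>\<close>.\<close>

lemma has_derivative_F_proj:
  assumes "\<mu> \<noteq> 0"
  shows "((\<lambda>\<nu>. F (proj \<nu>)) has_derivative
    (\<lambda>v. - 8 * inner v (delta \<mu> (M \<mu>)) / (inner \<mu> \<mu>)\<^sup>2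
      - 4 * inner (M \<mu>) (M \<mu>) * inner v \<mu> / (inner \<mu> \<mu>) ^ 3)) (at \<mu>)"
proof -
  obtain N where N: "(M has_derivative N) (at \<mu>)"
    using M_differentiable by (auto simp: differentiable_def)
  \<comment> \<open>With one factor frozen at \<open>M \<mu>\<close>, the pairing is the quadratic
    form \<open>- 2 * inner \<nu> (delta \<nu> (M \<mu>))\<close>. Self-adjointness merges the two
    terms of its derivative, and uniqueness of derivatives yields the equation.\<close>
  have "(\<lambda>v. inner (N v) (M \<mu>)) = (\<lambda>v. - 4 * inner v (delta \<mu> (M \<mu>)))"
  proof (rule has_derivative_unique)
    show "((\<lambda>\<nu>. inner (M \<nu>) (M \<mu>)) has_derivative (\<lambda>v. inner (N v) (M \<mu>))) (at \<mu>)"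
      by (rule has_derivative_inner_left[OF N])
    have "((\<lambda>\<nu>. - 2 * inner \<nu> (delta \<nu> (M \<mu>))) has_derivative
        (\<lambda>v. - 2 * (inner \<mu> (delta v (M \<mu>)) + inner v (delta \<mu> (M \<mu>))))) (at \<mu>)"
      by (intro has_derivative_mult_right has_derivative_inner has_derivative_ident
          bounded_linear_imp_has_derivative bounded_linear_delta)
    moreover have "inner \<mu> (delta v (M \<mu>)) = inner v (delta \<mu> (M \<mu>))" for v
      using inner_delta[OF hermitian_M] by (metis inner_commute)
    ultimately show "((\<lambda>\<nu>. inner (M \<nu>) (M \<mu>)) has_derivative
        (\<lambda>v. - 4 * inner v (delta \<mu> (M \<mu>)))) (at \<mu>)"
      by (simp add: inner_M[OF hermitian_M])
  qed
  then have N': "inner (N v) (M \<mu>) = - 4 * inner v (delta \<mu> (M \<mu>))" for v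
    by (simp add: fun_eq_iff)
  have pos: "inner \<mu> \<mu> > 0"
    using assms by simp
  have "((\<lambda>\<nu>. inner (M \<nu>) (M \<nu>) / (inner \<nu> \<nu>)\<^sup>2) has_derivative
    (\<lambda>v. - 8 * inner v (delta \<mu> (M \<mu>)) / (inner \<mu> \<mu>)\<^sup>2
      - 4 * inner (M \<mu>) (M \<mu>) * inner v \<mu> / (inner \<mu> \<mu>) ^ 3)) (at \<mu>)"
  proof (rule has_derivative_eq_rhs[OF has_derivative_divide'[OF has_derivative_inner[OF N N]
          has_derivative_power[OF has_derivative_inner[OF has_derivative_ident has_derivative_ident]]]])
    show "(inner \<mu> \<mu>)\<^sup>2 \<noteq> 0" using pos by simp
    have eq: "((y + y) * x\<^sup>2 - m * (of_nat 2 * (b + b) * x ^ (2 - 1))) / (x\<^sup>2 * x\<^sup>2) =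
        2 * y / x\<^sup>2 - 4 * m * b / x ^ 3" if "x > 0" for x y m b :: real
      using that by (simp add: divide_simps power2_eq_square power3_eq_cube) (simp add: algebra_simps)
    have "((inner (M \<mu>) (N v) + inner (N v) (M \<mu>)) * (inner \<mu> \<mu>)\<^sup>2 - inner (M \<mu>) (M \<mu>) *
          (of_nat 2 * (inner \<mu> v + inner v \<mu>) * inner \<mu> \<mu> ^ (2 - 1))) / ((inner \<mu> \<mu>)\<^sup>2 * (inner \<mu> \<mu>)\<^sup>2) =
        - 8 * inner v (delta \<mu> (M \<mu>)) / (inner \<mu> \<mu>)\<^sup>2 -
        4 * inner (M \<mu>) (M \<mu>) * inner v \<mu> / inner \<mu> \<mu> ^ 3" for v
      using eq[OF pos, of "inner (N v) (M \<mu>)" "inner (M \<mu>) (M \<mu>)" "inner v \<mu>"]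
      by (simp only: inner_commute[of "M \<mu>" "N v"] inner_commute[of \<mu> v] N')
    then show "(\<lambda>v. ((inner (M \<mu>) (N v) + inner (N v) (M \<mu>)) * (inner \<mu> \<mu>)\<^sup>2 - inner (M \<mu>) (M \<mu>) *
          (of_nat 2 * (inner \<mu> v + inner v \<mu>) * inner \<mu> \<mu> ^ (2 - 1))) / ((inner \<mu> \<mu>)\<^sup>2 * (inner \<mu> \<mu>)\<^sup>2)) =
      (\<lambda>v. - 8 * inner v (delta \<mu> (M \<mu>)) / (inner \<mu> \<mu>)\<^sup>2 -
        4 * inner (M \<mu>) (M \<mu>) * inner v \<mu> / inner \<mu> \<mu> ^ 3)"
      by (rule ext)
  qed
  \<comment> \<open>\<open>F_proj\<close> holds away from 0 only, so the derivative is transferred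
    on the open set of nonzero vectors.\<close>
  then show ?thesis
    by (rule has_derivative_transform_within_open[of _ _ _ _ "- {0}"]) (use assms in \<open>auto simp: F_proj\<close>)
qed

section \<open>Tangent vectors as functionals\<close>

lemma has_derivative_proj_cscale:
  assumes "((\<lambda>\<nu>. f (proj \<nu>)) has_derivative f') (at \<mu>)" "c \<noteq> 0"
  shows "((\<lambda>\<nu>. f (proj \<nu>)) has_derivative (\<lambda>v. f' (cscale (1 / c) v))) (at (cscale c \<mu>))"
proof -
  have "((\<lambda>\<nu>. f (proj (cscale (1 / c) \<nu>))) has_derivative (\<lambda>v. f' (cscale (1 / c) v)))
      (at (cscale c \<mu>))"
    by (rule has_derivative_compose[OF bounded_linear_imp_has_derivative[OF bounded_linear_cscale]])
      (use assms in simp)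
  then show ?thesis
    using assms(2) by (simp add: proj_cscale)
qed

lemma diff_at_proj:
  "diff_at f (proj \<mu>) \<longleftrightarrow> (\<lambda>\<nu>. f (proj \<nu>)) differentiable (at \<mu>)"
  using has_derivative_proj_cscale self_in_proj[of \<mu>]
  unfolding diff_at_def differentiable_def by (fastforce simp: proj_def)

lemma dproj_eq:
  assumes "((\<lambda>\<nu>. f (proj \<nu>)) has_derivative f') (at \<mu>)"
  shows "dproj \<mu> v f = f' v"
  using assms frechet_derivative_at[OF assms]
  by (auto simp: dproj_def diff_at_proj differentiable_def)

lemma dproj_not_diff_at: "\<not> diff_at f (proj \<mu>) \<Longrightarrow> dproj \<mu> v f = 0"
  by (simp add: dproj_def)

text \<open>Both functionals are 0 on functions that are not differentiable at the point, so only
  differentiable ones need a comparison.\<close>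

lemma dproj_eqI:
  assumes "proj \<mu> = proj \<nu>"
    and "\<And>f f'. ((\<lambda>\<kappa>. f (proj \<kappa>)) has_derivative f') (at \<mu>) \<Longrightarrow> dproj \<nu> w f = f' v"
  shows "dproj \<mu> v = dproj \<nu> w"
proof
  fix f
  show "dproj \<mu> v f = dproj \<nu> w f"
  proof (cases "diff_at f (proj \<mu>)")
    case True
    then obtain f' where "((\<lambda>\<nu>. f (proj \<nu>)) has_derivative f') (at \<mu>)"
      by (auto simp: diff_at_proj differentiable_def)
    then show ?thesis by (simp add: dproj_eq assms(2))
  next
    case False
    then show ?thesis using assms(1) by (simp add: dproj_not_diff_at)
  qed
qed

lemma dproj_cscale:
  assumes "c \<noteq> 0"
  shows "dproj (cscale c \<mu>) v = dproj \<mu> (cscale (1 / c) v)"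
proof (rule dproj_eqI[symmetric])
  show "dproj (cscale c \<mu>) v f = f' (cscale (1 / c) v)"
    if "((\<lambda>\<kappa>. f (proj \<kappa>)) has_derivative f') (at \<mu>)" for f f'
    by (rule dproj_eq[OF has_derivative_proj_cscale[OF that assms]])
qed (simp add: proj_cscale assms)

lemma dproj_add: "dproj \<mu> (v + w) f = dproj \<mu> v f + dproj \<mu> w f"
  and dproj_scaleR: "dproj \<mu> (r *\<^sub>R v) f = r * dproj \<mu> v f"
proof -
  have "dproj \<mu> (v + w) f = dproj \<mu> v f + dproj \<mu> w f \<and> dproj \<mu> (r *\<^sub>R v) f = r * dproj \<mu> v f"
  proof (cases "diff_at f (proj \<mu>)")
    case True
    then obtain f' where f': "((\<lambda>\<nu>. f (proj \<nu>)) has_derivative f') (at \<mu>)"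
      by (auto simp: diff_at_proj differentiable_def)
    then show ?thesis
      using has_derivative_linear[OF f'] by (simp add: dproj_eq linear_iff)
  qed (simp add: dproj_not_diff_at)
  then show "dproj \<mu> (v + w) f = dproj \<mu> v f + dproj \<mu> w f"
    "dproj \<mu> (r *\<^sub>R v) f = r * dproj \<mu> v f" by auto
qed

lemma dproj_diff: "dproj \<mu> (v - w) f = dproj \<mu> v f - dproj \<mu> w f"
  using dproj_add[of \<mu> "v - w" w f] by simp

lemma velocity_proj:
  assumes "(c has_vector_derivative v) (at 0)"
  shows "velocity (\<lambda>t. proj (c t)) = dproj (c 0) v"
proof
  fix f
  show "velocity (\<lambda>t. proj (c t)) f = dproj (c 0) v f"
  proof (cases "diff_at f (proj (c 0))")
    case True
    then obtain f' where f': "((\<lambda>\<nu>. f (proj \<nu>)) has_derivative f') (at (c 0))"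
      by (auto simp: diff_at_proj differentiable_def)
    from has_derivative_compose[OF assms[unfolded has_vector_derivative_def] this]
    have "((\<lambda>t. f (proj (c t))) has_derivative (\<lambda>t. f' v * t)) (at 0)"
      using has_derivative_linear[OF f'] by (simp add: linear_iff mult.commute)
    then have "deriv (\<lambda>t. f (proj (c t))) 0 = f' v"
      by (intro DERIV_imp_deriv) (simp add: has_field_derivative_def)
    with True show ?thesis
      by (simp add: velocity_def dproj_eq[OF f'])
  qed (simp add: velocity_def dproj_not_diff_at)
qed

text \<open>The curve \<open>c\<close> stays in the complex line of \<open>\<mu>\<close>, and near
  \<open>t = 0\<close> it avoids the origin, so \<open>f (proj (c t))\<close> is constant
  there.\<close>

lemma dproj_cscale_self: "dproj \<mu> (cscale z \<mu>) f = 0"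
proof (cases "diff_at f (proj \<mu>)")
  case True
  then obtain f' where f': "((\<lambda>\<nu>. f (proj \<nu>)) has_derivative f') (at \<mu>)"
    by (auto simp: diff_at_proj differentiable_def)
  define c where "c t = \<mu> + t *\<^sub>R cscale z \<mu>" for t :: real
  have c_eq: "c t = cscale (1 + complex_of_real t * z) \<mu>" for t
    by (intro alt_eqI)
      (simp add: c_def plus_alt.rep_eq cscale.rep_eq cscale_of_real[symmetric] vector_sadd_rdistrib)
  have "(c has_derivative (\<lambda>t. t *\<^sub>R cscale z \<mu>)) (at 0)"
    unfolding c_def by (auto intro!: derivative_eq_intros)
  from has_derivative_compose[OF this, of "\<lambda>\<nu>. f (proj \<nu>)" f'] f'
  have "((\<lambda>t. f (proj (c t))) has_derivative (\<lambda>t. f' (t *\<^sub>R cscale z \<mu>))) (at 0)"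
    by (simp add: c_def)
  moreover have "((\<lambda>t. f (proj (c t))) has_derivative (\<lambda>t. 0)) (at 0)"
  proof (rule has_derivative_transform_within_open[OF has_derivative_const])
    show "open {t. 1 + complex_of_real t * z \<noteq> 0}"
      by (intro open_Collect_neq continuous_intros)
  qed (auto simp: c_eq proj_cscale)
  ultimately have "(\<lambda>t. f' (t *\<^sub>R cscale z \<mu>)) = (\<lambda>t. 0)"
    by (rule has_derivative_unique)
  then have "f' (1 *\<^sub>R cscale z \<mu>) = 0" by meson
  then show ?thesis by (simp add: dproj_eq[OF f'])
qed (simp add: dproj_not_diff_at)

text \<open>The functions \<open>[\<nu>] \<mapsto> |\<langle>\<nu>, \<lambda>\<rangle>|\<^sup>2 / \<parallel>\<nu>\<parallel>\<^sup>2\<close> separate horizontal vectors.\<close>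

lemma dproj_eq_0_imp:
  assumes "\<mu> \<noteq> 0" "herm_alt v \<mu> = 0" "dproj \<mu> v = (\<lambda>f. 0)"
  shows "v = 0"
proof -
  \<comment> \<open>The choice of \<open>\<mu> + v\<close> makes \<open>h v\<close> and
    \<open>h \<mu>\<close> the squared norms of \<open>v\<close> and \<open>\<mu>\<close>. The
    derivative in direction \<open>v\<close> is then \<open>2 * inner v v\<close>; pairing with
    \<open>v\<close> alone would vanish at \<open>\<mu>\<close> and give derivative 0.\<close>
  define h where "h \<nu> = herm_alt \<nu> (\<mu> + v)" for \<nu>
  define g where "g \<nu> = inner (h \<nu>) (h \<nu>) / inner \<nu> \<nu>" for \<nu>
  \<comment> \<open>An arbitrary representative may be chosen because \<open>g\<close> is invariant
    under nonzero scalars.\<close>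
  define f where "f p = g (SOME \<nu>. \<nu> \<in> p)" for p
  have g_cscale: "g (cscale c \<nu>) = g \<nu>" if "c \<noteq> 0" for c \<nu>
    using that by (simp add: g_def h_def herm_alt_cscale_left norm_cscale norm_mult
        power_mult_distrib flip: power2_norm_eq_inner)
  have f_proj: "f (proj \<nu>) = g \<nu>" for \<nu>
  proof -
    have "(SOME \<kappa>. \<kappa> \<in> proj \<nu>) \<in> proj \<nu>"
      using self_in_proj by (rule someI)
    then show ?thesis
      using g_cscale by (auto simp: f_def proj_def)
  qed
  have h: "(h has_derivative h) (at \<mu>)"
    unfolding h_def[abs_def]
    by (rule bounded_linear_imp_has_derivative[OF bounded_linear_herm_alt])
  have "herm_alt \<mu> v = 0"
    using assms(2) herm_alt_commute[of \<mu> v] by simp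
  then have hv: "h v = complex_of_real (inner v v)" and h\<mu>: "h \<mu> = complex_of_real (inner \<mu> \<mu>)"
    using assms(2) by (simp_all add: h_def herm_alt_add_right herm_alt_self power2_norm_eq_inner)
  have "((\<lambda>\<nu>. f (proj \<nu>)) has_derivative
      (\<lambda>w. (2 * inner (h w) (h \<mu>) * inner \<mu> \<mu> - inner (h \<mu>) (h \<mu>) * (2 * inner w \<mu>)) /
        (inner \<mu> \<mu> * inner \<mu> \<mu>))) (at \<mu>)"
    unfolding f_proj g_def using assms(1)
    by (intro has_derivative_eq_rhs[OF has_derivative_divide'[OF has_derivative_inner[OF h h]
          has_derivative_inner[OF has_derivative_ident has_derivative_ident]]])
      (auto simp: fun_eq_iff inner_commute)
  from dproj_eq[OF this, of v] have "2 * inner v v = 0"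
    using assms Re_herm_alt[of v \<mu>] by (simp add: hv h\<mu> inner_complex_def)
  then show ?thesis by simp
qed

text \<open>For nonzero \<open>\<mu>\<close>, of any norm, this is the hermitian orthogonal
  projection along the complex line of \<open>\<mu>\<close>.\<close>

definition hpart :: "'n::finite alt \<Rightarrow> 'n alt \<Rightarrow> 'n alt"
  where "hpart \<mu> v = v - cscale (herm_alt v \<mu> / herm_alt \<mu> \<mu>) \<mu>"

lemma herm_alt_diff_left: "herm_alt (\<mu> - \<nu>) \<kappa> = herm_alt \<mu> \<kappa> - herm_alt \<nu> \<kappa>"
  using herm_alt_add_left[of "\<mu> - \<nu>" \<nu> \<kappa>] by simp

lemma herm_alt_hpart: "\<mu> \<noteq> 0 \<Longrightarrow> herm_alt (hpart \<mu> v) \<mu> = 0"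
  by (simp add: hpart_def herm_alt_diff_left herm_alt_cscale_left herm_alt_self)

lemma dproj_hpart: "dproj \<mu> (hpart \<mu> v) = dproj \<mu> v"
  by (simp add: fun_eq_iff hpart_def dproj_diff dproj_cscale_self)

text \<open>The kernel of \<open>dproj \<mu>\<close> is the complex line of \<open>\<mu>\<close>,
  and real orthogonality to both \<open>\<mu>\<close> and \<open>cscale \<i> \<mu>\<close> is
  hermitian orthogonality to \<open>\<mu>\<close>.\<close>

lemma horizontal_iff:
  assumes "\<mu> \<noteq> 0"
  shows "v \<in> horizontal \<mu> \<longleftrightarrow> herm_alt v \<mu> = 0"
proof
  assume v: "v \<in> horizontal \<mu>"
  have "inner (cscale \<i> \<mu>) \<mu> = 0"
    by (simp add: Re_herm_alt[symmetric] herm_alt_cscale_left herm_alt_self)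
  then have "inner v (cscale \<i> \<mu>) = 0"
    using v dproj_cscale_self[of \<mu> \<i>] by (simp add: horizontal_def fun_eq_iff)
  moreover have "inner v \<mu> = 0"
    using v by (simp add: horizontal_def)
  ultimately show "herm_alt v \<mu> = 0"
    by (simp add: Re_herm_alt[symmetric] herm_alt_cscale_right complex_eq_iff)
next
  assume v: "herm_alt v \<mu> = 0"
  have "inner v w = 0" if "dproj \<mu> w = (\<lambda>f. 0)" for w
  proof -
    \<comment> \<open>The projection lies in the kernel together with \<open>w\<close>, so it
      vanishes and \<open>w\<close> is a complex multiple of \<open>\<mu>\<close>.\<close>
    have "hpart \<mu> w = 0"
      using assms that by (intro dproj_eq_0_imp[OF assms herm_alt_hpart]) (simp_all add: dproj_hpart)
    then show ?thesis
      using v by (metis Re_herm_alt eq_iff_diff_eq_0 herm_alt_cscale_right hpart_def mult_zero_right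
          zero_complex.sel(1))
  qed
  then show "v \<in> horizontal \<mu>"
    using v by (simp add: horizontal_def Re_herm_alt[symmetric])
qed

lemma hpart_in_horizontal: "\<mu> \<noteq> 0 \<Longrightarrow> hpart \<mu> v \<in> horizontal \<mu>"
  by (simp add: horizontal_iff herm_alt_hpart)

lemma dproj_horizontal_inject:
  assumes "\<mu> \<noteq> 0" "v \<in> horizontal \<mu>" "w \<in> horizontal \<mu>" "dproj \<mu> v = dproj \<mu> w"
  shows "v = w"
proof -
  have "v - w = 0"
    using assms by (intro dproj_eq_0_imp[of \<mu>])
      (simp_all add: horizontal_iff herm_alt_diff_left fun_eq_iff dproj_diff)
  then show ?thesis by simp
qed

section \<open>Tangent spaces and the Fubini-Study metric\<close>

lemma tangent_space_subset:
  assumes "\<xi> \<in> tangent_space S (proj \<mu>)"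
  shows "\<xi> \<in> range (dproj \<mu>)"
proof -
  obtain c :: "real \<Rightarrow> 'a alt" where c: "c differentiable (at 0)" "proj (c 0) = proj \<mu>" "\<xi> = velocity (\<lambda>t. proj (c t))"
  proof -
    obtain \<gamma> where \<gamma>: "\<xi> = velocity \<gamma>" "curve_at \<gamma> (proj \<mu>)"
      using assms by (auto simp: tangent_space_def)
    then obtain c where c: "c differentiable (at 0)" "\<And>t. \<gamma> t = proj (c t)" "\<gamma> 0 = proj \<mu>"
      unfolding curve_at_def by blast
    from c(2) have "\<gamma> = (\<lambda>t. proj (c t))" by (rule ext)
    then show ?thesis
      using that[OF c(1)] c(3) \<gamma>(1) by simp
  qed
  \<comment> \<open>The lift of the curve may start at another representative;
    \<open>dproj_cscale\<close> moves its velocity back to \<open>\<mu>\<close>.\<close>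
  obtain z where z: "z \<noteq> 0" "c 0 = cscale z \<mu>"
    using proj_eqD[OF c(2)] by blast
  obtain v where "(c has_vector_derivative v) (at 0)"
    using c(1) vector_derivative_works by blast
  from velocity_proj[OF this] have "\<xi> = dproj \<mu> (cscale (1 / z) v)"
    by (simp add: c(3) z dproj_cscale)
  then show ?thesis by blast
qed

lemma tangent_space_PV:
  assumes "\<mu> \<noteq> 0"
  shows "tangent_space PV (proj \<mu>) = dproj \<mu> ` horizontal \<mu>"
proof (intro subset_antisym subsetI)
  fix \<xi> assume "\<xi> \<in> tangent_space PV (proj \<mu>)"
  then obtain v where "\<xi> = dproj \<mu> (hpart \<mu> v)"
    using tangent_space_subset by (fastforce simp: dproj_hpart)
  then show "\<xi> \<in> dproj \<mu> ` horizontal \<mu>"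
    using hpart_in_horizontal[OF assms] by blast
next
  fix \<xi> assume "\<xi> \<in> dproj \<mu> ` horizontal \<mu>"
  then obtain v where v: "herm_alt v \<mu> = 0" "\<xi> = dproj \<mu> v"
    by (auto simp: horizontal_iff assms)
  \<comment> \<open>A straight line realizes \<open>v\<close>. Since \<open>v\<close> is orthogonal
    to \<open>\<mu>\<close>, it misses the origin for every \<open>t\<close>, as
    \<open>curve_at\<close> demands.\<close>
  define c where "c t = \<mu> + t *\<^sub>R v" for t :: real
  have c: "(c has_vector_derivative v) (at 0)"
    unfolding c_def by (auto intro!: derivative_eq_intros)
  have nz: "c t \<noteq> 0" for t
  proof
    assume "c t = 0"
    then have "herm_alt (c t) \<mu> = 0"
      using herm_alt_cscale_left[of 0 0 \<mu>] by simp
    then show False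
      using v(1) assms
      by (simp add: c_def herm_alt_add_left cscale_of_real[symmetric] herm_alt_cscale_left
          herm_alt_self)
  qed
  have "curve_at (\<lambda>t. proj (c t)) (proj \<mu>)"
    unfolding curve_at_def using c nz
    by (auto simp: c_def[of 0] has_vector_derivative_def differentiable_def)
  moreover have "range (\<lambda>t. proj (c t)) \<subseteq> PV"
    using nz by (auto simp: PV_def)
  moreover have "velocity (\<lambda>t. proj (c t)) = \<xi>"
    using velocity_proj[OF c] v(2) by (simp add: c_def)
  ultimately show "\<xi> \<in> tangent_space PV (proj \<mu>)"
    unfolding tangent_space_def by blast
qed

lemma inner_cscale_cscale: "inner (cscale c v) (cscale c w) = (cmod c)\<^sup>2 * inner v w"
proof -
  have "herm_alt (cscale c v) (cscale c w) = complex_of_real ((cmod c)\<^sup>2) * herm_alt v w"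
    by (simp only: herm_alt_cscale_left herm_alt_cscale_right complex_norm_square mult_ac)
  then show ?thesis
    unfolding Re_herm_alt[symmetric] by (simp del: of_real_power)
qed

text \<open>Two unit representatives differ by a phase \<open>c\<close>. Multiplication by
  \<open>1 / c\<close> carries horizontal lifts at one to those at the other and preserves inner
  products, so the value is well defined.\<close>

lemma fubini_study_dproj:
  assumes "norm \<mu> = 1" "v \<in> horizontal \<mu>" "w \<in> horizontal \<mu>"
  shows "fubini_study (proj \<mu>) (dproj \<mu> v) (dproj \<mu> w) = inner v w"
  unfolding fubini_study_def
proof (rule the_equality)
  show "\<exists>\<nu> v' w'. norm \<nu> = 1 \<and> proj \<nu> = proj \<mu> \<and> v' \<in> horizontal \<nu> \<and> w' \<in> horizontal \<nu> \<and>
      dproj \<nu> v' = dproj \<mu> v \<and> dproj \<nu> w' = dproj \<mu> w \<and> inner v w = inner v' w'"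
    using assms by blast
next
  fix r
  assume "\<exists>\<nu> v' w'. norm \<nu> = 1 \<and> proj \<nu> = proj \<mu> \<and> v' \<in> horizontal \<nu> \<and> w' \<in> horizontal \<nu> \<and>
      dproj \<nu> v' = dproj \<mu> v \<and> dproj \<nu> w' = dproj \<mu> w \<and> r = inner v' w'"
  then obtain \<nu> v' w' where *: "norm \<nu> = 1" "proj \<nu> = proj \<mu>" "v' \<in> horizontal \<nu>" "w' \<in> horizontal \<nu>"
    "dproj \<nu> v' = dproj \<mu> v" "dproj \<nu> w' = dproj \<mu> w" "r = inner v' w'"
    by blast
  obtain c where c: "c \<noteq> 0" "\<nu> = cscale c \<mu>"
    using proj_eqD[OF *(2)] by blast
  have "\<mu> \<noteq> 0" "\<nu> \<noteq> 0" and norm_c: "cmod c = 1"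
    using assms(1) *(1) c by (auto simp: norm_cscale)
  have eq: "cscale (1 / c) x' = x"
    if "x' \<in> horizontal \<nu>" "x \<in> horizontal \<mu>" "dproj \<nu> x' = dproj \<mu> x" for x x'
  proof (rule dproj_horizontal_inject[OF \<open>\<mu> \<noteq> 0\<close> _ that(2)])
    show "cscale (1 / c) x' \<in> horizontal \<mu>"
      using that(1) c \<open>\<mu> \<noteq> 0\<close> \<open>\<nu> \<noteq> 0\<close>
      by (simp add: horizontal_iff herm_alt_cscale_left herm_alt_cscale_right)
    show "dproj \<mu> (cscale (1 / c) x') = dproj \<mu> x"
      using that(3) c by (simp add: dproj_cscale)
  qed
  have "inner v w = inner (cscale (1 / c) v') (cscale (1 / c) w')"
    using eq[OF *(3) assms(2) *(5)] eq[OF *(4) assms(3) *(6)] by simp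
  then show "r = inner v w"
    using *(7) norm_c by (simp add: inner_cscale_cscale norm_divide)
qed

subsection \<open>Critical points\<close>

lemma diff_at_F: "\<mu> \<noteq> 0 \<Longrightarrow> diff_at F (proj \<mu>)"
  using has_derivative_F_proj by (auto simp: diff_at_proj differentiable_def)

lemma dproj_F:
  assumes "\<mu> \<noteq> 0" "v \<in> horizontal \<mu>"
  shows "dproj \<mu> v F = - 8 * inner v (delta \<mu> (M \<mu>)) / (inner \<mu> \<mu>)\<^sup>2"
proof -
  have "inner v \<mu> = 0"
    using assms(2) by (simp add: horizontal_def)
  then show ?thesis
    by (simp add: dproj_eq[OF has_derivative_F_proj[OF assms(1)]])
qed

lemma inner_hpart:
  assumes "\<mu> \<noteq> 0" "w \<in> horizontal \<mu>"
  shows "inner w (hpart \<mu> v) = inner w v"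
  using assms Re_herm_alt[of w "cscale (herm_alt v \<mu> / herm_alt \<mu> \<mu>) \<mu>"]
  by (simp add: hpart_def inner_diff_right horizontal_iff herm_alt_cscale_right)

lemma grad_F_proj:
  assumes "norm \<mu> = 1"
  shows "grad F (proj \<mu>) = (\<lambda>f. - 8 * dproj \<mu> (delta \<mu> (M \<mu>)) f)"
proof -
  have [simp]: "\<mu> \<noteq> 0" using assms by auto
  have \<mu>1: "inner \<mu> \<mu> = 1"
    using assms by (simp add: norm_eq_1)
  \<comment> \<open>The horizontal lift of the gradient: the projection changes neither pairings
    with horizontal vectors nor the image under \<open>dproj\<close>.\<close>
  define v where "v = hpart \<mu> ((- 8) *\<^sub>R delta \<mu> (M \<mu>))"
  have v: "v \<in> horizontal \<mu>"
    by (simp add: v_def hpart_in_horizontal)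
  have dF: "dproj \<mu> w F = inner v w" if "w \<in> horizontal \<mu>" for w
    using that inner_hpart[of \<mu> w "(- 8) *\<^sub>R delta \<mu> (M \<mu>)"]
    by (simp add: dproj_F v_def \<mu>1 inner_commute)
  have "grad F (proj \<mu>) = dproj \<mu> v"
    unfolding grad_def
  proof (rule the_equality)
    show "diff_at F (proj \<mu>) \<and> dproj \<mu> v \<in> tangent_space PV (proj \<mu>) \<and>
      (\<forall>\<eta>\<in>tangent_space PV (proj \<mu>). fubini_study (proj \<mu>) (dproj \<mu> v) \<eta> = \<eta> F)"
      using v by (auto simp: diff_at_F tangent_space_PV fubini_study_dproj assms dF)
  next
    fix \<xi>
    assume \<xi>: "diff_at F (proj \<mu>) \<and> \<xi> \<in> tangent_space PV (proj \<mu>) \<and>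
      (\<forall>\<eta>\<in>tangent_space PV (proj \<mu>). fubini_study (proj \<mu>) \<xi> \<eta> = \<eta> F)"
    then obtain u where u: "u \<in> horizontal \<mu>" "\<xi> = dproj \<mu> u"
      by (auto simp: tangent_space_PV)
    \<comment> \<open>Any other candidate has a lift \<open>u\<close> with the same pairings;
      testing on the horizontal vector \<open>u - v\<close> forces equality.\<close>
    have "inner u w = inner v w" if "w \<in> horizontal \<mu>" for w
      using \<xi> u that by (simp add: tangent_space_PV fubini_study_dproj assms dF)
    moreover have "u - v \<in> horizontal \<mu>"
      using u v by (simp add: horizontal_iff herm_alt_diff_left)
    ultimately have "inner (u - v) (u - v) = 0"
      by (simp add: inner_diff_left)
    then show "\<xi> = dproj \<mu> v"
      using u by simp
  qed
  also have "\<dots> = dproj \<mu> ((- 8) *\<^sub>R delta \<mu> (M \<mu>))"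
    by (simp only: v_def dproj_hpart)
  finally show ?thesis
    by (simp only: fun_eq_iff dproj_scaleR) simp
qed

lemma hpart_delta_eq_0_iff:
  assumes "\<mu> \<noteq> 0"
  shows "hpart \<mu> (delta \<mu> (M \<mu>)) = 0 \<longleftrightarrow>
    (\<exists>c::real. \<exists>D\<in>Der \<mu>. M \<mu> = mat (complex_of_real c) + D)"
proof
  assume 0: "hpart \<mu> (delta \<mu> (M \<mu>)) = 0"
  \<comment> \<open>The coefficient removed by \<open>hpart\<close> is this real number, by
    \<open>herm_alt_delta_self\<close>.\<close>
  define c where "c = inner (delta \<mu> (M \<mu>)) \<mu> / (norm \<mu>)\<^sup>2"
  have "delta \<mu> (M \<mu>) = cscale (complex_of_real c) \<mu>"
    using 0 by (simp add: hpart_def herm_alt_delta_self[OF hermitian_M] herm_alt_self c_def)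
  then have "M \<mu> - mat (complex_of_real c) \<in> Der \<mu>"
    by (simp add: Der_def delta_diff_right delta_mat)
  then show "\<exists>c::real. \<exists>D\<in>Der \<mu>. M \<mu> = mat (complex_of_real c) + D"
    by (intro exI[of _ c] bexI[of _ "M \<mu> - mat (complex_of_real c)"]) simp_all
next
  assume "\<exists>c::real. \<exists>D\<in>Der \<mu>. M \<mu> = mat (complex_of_real c) + D"
  then obtain c D where "D \<in> Der \<mu>" "M \<mu> = mat (complex_of_real c) + D"
    by blast
  then have "delta \<mu> (M \<mu> - mat (complex_of_real c)) = 0"
    by (simp add: Der_def)
  then have "delta \<mu> (M \<mu>) = cscale (complex_of_real c) \<mu>"
    by (simp add: delta_diff_right delta_mat)
  then show "hpart \<mu> (delta \<mu> (M \<mu>)) = 0"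
    using assms by (simp add: hpart_def herm_alt_cscale_left herm_alt_self)
qed

section \<open>Tangent directions of the orbits\<close>

lemma act_eq_0:
  assumes "invertible g" "act g \<mu> = 0"
  shows "\<mu> = 0"
proof (rule app_eq_0I)
  fix i j
  have "matrix_inv g ** g = mat 1"
    by (rule matrix_inv_mult_left[OF assms(1)])
  then have inv: "matrix_inv g *v (g *v x) = x" for x
    by (simp add: matrix_vector_mul_assoc)
  have "g *v app \<mu> (matrix_inv g *v (g *v axis i 1)) (matrix_inv g *v (g *v axis j 1)) = 0"
    using assms(2) by (metis act.rep_eq zero_alt.rep_eq)
  then have "matrix_inv g *v (g *v app \<mu> (axis i 1) (axis j 1)) = 0"
    by (simp only: inv) simp
  then show "app \<mu> (axis i 1) (axis j 1) = 0"
    by (simp only: inv)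
qed

lemma proj_in_orbit: "proj \<mu> \<in> orbit (proj \<mu>)"
  unfolding orbit_def using act_proj[of "mat 1" \<mu>] invertible_mat_1 by force

lemma orbit_subset_PV: "\<mu> \<noteq> 0 \<Longrightarrow> orbit (proj \<mu>) \<subseteq> PV"
  using act_eq_0 by (fastforce simp: orbit_def PV_def act_proj)

lemma dproj_delta_in_tangent_space_orbit:
  assumes "\<mu> \<noteq> 0"
  shows "dproj \<mu> (- delta \<mu> A) \<in> tangent_space (orbit (proj \<mu>)) (proj \<mu>)"
proof -
  \<comment> \<open>\<open>curve_at\<close> asks for nonzero lifts at every \<open>t\<close>, so the
    path is reset to the identity wherever it is singular; near 0 nothing changes.\<close>
  define g where "g t = (if invertible (mat 1 + t *\<^sub>R A) then mat 1 + t *\<^sub>R A else mat 1)" for t :: real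
  define c where "c t = act (g t) \<mu>" for t
  have inv: "invertible (g t)" for t
    by (simp add: g_def invertible_mat_1)
  have "\<forall>\<^sub>F t in at 0. invertible (mat 1 + t *\<^sub>R A)"
  proof -
    have "isCont (\<lambda>t. mat 1 + t *\<^sub>R A) 0"
      by (intro continuous_intros)
    then have "((\<lambda>t. mat 1 + t *\<^sub>R A) \<longlongrightarrow> mat 1) (at (0::real))"
      by (simp add: isCont_def)
    \<comment> \<open>The full neighbourhood filter is used because the path may hit
      \<open>mat 1\<close> itself, for instance when \<open>A\<close> is 0.\<close>
    moreover have "\<forall>\<^sub>F h in nhds (mat 1). invertible (h :: complex^'a^'a)"
      unfolding eventually_nhds_conv_at 
      by (simp add: eventually_invertible invertible_mat_1)
    ultimately show ?thesis
      by (rule eventually_compose_filterlim[rotated])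
  qed
  then have ev: "\<forall>\<^sub>F t in at 0. mat 1 + t *\<^sub>R A = g t"
    by eventually_elim (simp add: g_def)
  have "((\<lambda>t. mat 1 + t *\<^sub>R A) has_derivative (\<lambda>t. t *\<^sub>R A)) (at (0::real))"
    by (auto intro!: derivative_eq_intros)
  then have "(g has_derivative (\<lambda>t. t *\<^sub>R A)) (at 0)"
    by (rule has_derivative_transform_eventually[OF _ ev]) (simp_all add: g_def)
  from has_derivative_compose[OF this, of "\<lambda>g. act g \<mu>" "\<lambda>A. - delta \<mu> A"] has_derivative_act[of \<mu>]
  have "(c has_derivative (\<lambda>t. - delta \<mu> (t *\<^sub>R A))) (at 0)"
    by (simp add: g_def[of 0] c_def[abs_def])
  moreover have "delta \<mu> (t *\<^sub>R A) = t *\<^sub>R delta \<mu> A" for t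
    by (rule alt_eqI) (simp add: vec_eq_iff app_delta_axis scaleR_alt_def cscale.rep_eq
        scaleR_conv_of_real[where 'a = complex] sum_distrib_left algebra_simps)
  ultimately have c: "(c has_vector_derivative (- delta \<mu> A)) (at 0)"
    by (simp add: has_vector_derivative_def)
  have c0: "c 0 = \<mu>"
    by (simp add: c_def g_def)
  have "c t \<noteq> 0" for t
    using act_eq_0[OF inv] assms by (auto simp: c_def)
  then have "curve_at (\<lambda>t. proj (c t)) (proj \<mu>)"
    unfolding curve_at_def using c c0 by (auto simp: has_vector_derivative_def differentiable_def)
  moreover have "range (\<lambda>t. proj (c t)) \<subseteq> orbit (proj \<mu>)"
    unfolding c_def orbit_def act_proj[symmetric] using inv by blast
  moreover have "velocity (\<lambda>t. proj (c t)) = dproj \<mu> (- delta \<mu> A)"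
    using velocity_proj[OF c] c0 by simp
  ultimately show ?thesis
    unfolding tangent_space_def by (intro CollectI exI[of _ "\<lambda>t. proj (c t)"]) simp
qed

text \<open>Curves in \<open>T\<close> are curves in \<open>S\<close>, so the tangent space shrinks
  with the set.\<close>

lemma critical_point_mono:
  assumes "critical_point S f p" "p \<in> T" "T \<subseteq> S"
  shows "critical_point T f p"
  using assms unfolding critical_point_def tangent_space_def by blast

theorem proposition3p2:
  "(\<forall>\<mu> :: 'n::finite alt. norm \<mu> = 1 \<longrightarrow>
      moment (proj \<mu>) = M \<mu> \<and>
      complex_of_real (F (proj \<mu>)) = trace (M \<mu> ** M \<mu>) \<and>
      grad F (proj \<mu>) = (\<lambda>f. - 8 * dproj \<mu> (delta \<mu> (M \<mu>)) f)) \<and>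
   (\<forall>\<mu> :: 'n alt. \<mu> \<noteq> 0 \<longrightarrow>
      (critical_point PV F (proj \<mu>) \<longleftrightarrow>
        critical_point (orbit (proj \<mu>)) F (proj \<mu>)) \<and>
      (critical_point PV F (proj \<mu>) \<longleftrightarrow>
        (\<exists>c::real. \<exists>D\<in>Der \<mu>. M \<mu> = mat (complex_of_real c) + D)))"
proof (intro conjI allI impI)
  fix \<mu> :: "'n alt" assume \<mu>: "norm \<mu> = 1"
  then have "\<mu> \<noteq> 0" by auto
  then show moment: "moment (proj \<mu>) = M \<mu>"
    by (simp add: moment_proj \<mu>)
  have "trace (M \<mu> ** M \<mu>) = gl_inner (M \<mu>) (M \<mu>)"
    using hermitian_M[of \<mu>] by (simp add: gl_inner_def hermitian_def)
  then show "complex_of_real (F (proj \<mu>)) = trace (M \<mu> ** M \<mu>)"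
    by (simp add: F_def moment Re_gl_inner gl_inner_hermitian hermitian_M)
  show "grad F (proj \<mu>) = (\<lambda>f. - 8 * dproj \<mu> (delta \<mu> (M \<mu>)) f)"
    by (rule grad_F_proj[OF \<mu>])
next
  fix \<mu> :: "'n alt" assume \<mu>: "\<mu> \<noteq> 0"
  let ?h = "hpart \<mu> (delta \<mu> (M \<mu>))"
  have PV: "critical_point PV F (proj \<mu>)" if "?h = 0"
  proof -
    have "inner v (delta \<mu> (M \<mu>)) = 0" if "v \<in> horizontal \<mu>" for v
      using inner_hpart[OF \<mu> that] \<open>?h = 0\<close> by (metis inner_zero_right)
    moreover have "proj \<mu> \<in> PV"
      using \<mu> by (auto simp: PV_def)
    ultimately show ?thesis
      using \<mu> by (auto simp: critical_point_def diff_at_F tangent_space_PV dproj_F)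
  qed
  have h: "?h = 0" if "critical_point (orbit (proj \<mu>)) F (proj \<mu>)"
  proof -
    \<comment> \<open>A single orbit direction is tested, the one generated by
      \<open>M \<mu>\<close>; its horizontal part is \<open>- ?h\<close>.\<close>
    have "dproj \<mu> (- delta \<mu> (M \<mu>)) F = 0"
      using that dproj_delta_in_tangent_space_orbit[OF \<mu>] by (auto simp: critical_point_def)
    then have "dproj \<mu> (delta \<mu> (M \<mu>)) F = 0"
      using dproj_scaleR[of \<mu> "- 1"] by simp
    then have "inner ?h (delta \<mu> (M \<mu>)) = 0"
      using dproj_F[OF \<mu> hpart_in_horizontal[OF \<mu>]] \<mu> by (simp add: dproj_hpart)
    then have "inner ?h ?h = 0"
      by (simp add: inner_hpart[OF \<mu> hpart_in_horizontal[OF \<mu>]])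
    then show ?thesis by simp
  qed
  have orbit: "critical_point (orbit (proj \<mu>)) F (proj \<mu>)" if "critical_point PV F (proj \<mu>)"
    by (rule critical_point_mono[OF that proj_in_orbit orbit_subset_PV[OF \<mu>]])
  show "critical_point PV F (proj \<mu>) \<longleftrightarrow> critical_point (orbit (proj \<mu>)) F (proj \<mu>)"
    using PV h orbit by blast
  show "critical_point PV F (proj \<mu>) \<longleftrightarrow>
      (\<exists>c::real. \<exists>D\<in>Der \<mu>. M \<mu> = mat (complex_of_real c) + D)"
    using PV h orbit hpart_delta_eq_0_iff[OF \<mu>] by blast
qed

end
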